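(* Suppose that $F$ is boundedly Lipschitz with constants $L$ and $D$: $\|F(z_1)-F(z_2)\|^2\le L^2\|z_1-z_2\|^2+D^2$ for all $z_1,z_2\in\mathcal Z$. Let $Q$ be a quantization with parameter $\omega$, and let the iterates be generated by Quant-ES: $z^0=w^0\in\mathcal Z$ and, for $k=0,\dots,K-1$, $\bar z^k=\tau z^k+(1-\tau)w^k$, $$z^{k+1/2}=\mathrm{prox}_{\gamma h}(\bar z^k-\gamma F(w^k)),\quad z^{k+1}=\mathrm{prox}_{\gamma h}\big(\bar z^k-\gamma Q(F(z^{k+1/2})-F(w^k))-\gamma F(w^k)\big),$$ $w^{k+1}=z^{k+1}$ with probability $1-\tau$ and $w^{k+1}=w^k$ with probability $\tau$. Then: (i) in the strongly monotone case with $0<\gamma\le\min\left\{\frac{\sqrt{1-\tau}}{2L\sqrt{2\omega}};\frac{1-\tau}{4(\mu_F+\mu_h)}\right\}$, $$\mathbb{E}\big[\tau\|z^K-z^*\|^2+\|w^K-z^*\|^2\big]\le\left(1-\gamma\cdot\frac{\mu_F+\mu_h}{16}\right)^{K-1}\big(\tau\|z^0-z^*\|^2+\|w^0-z^*\|^2\big)+\frac{32\gamma\omega D^2}{\mu_F+\mu_h};$$ (ii) in the monotone case with $0<\gamma\le\frac{\sqrt{1-\tau}}{2L\sqrt{4\omega+2}}$, $$\mathbb{E}[\mathrm{Gap}(\hat z^K)]\le\frac{8\max_{u\in\mathcal C}\|z^0-u\|^2}{\gamma K}+\gamma(9\omega+2)D^2,\qquad\hat z^K=\frac1K\sum_{k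=0}^{K-1}z^{k+1/2}.$$
   Context: A quantization with parameter $\omega$ is a random map $Q:\mathbb{R}^d\to\mathbb{R}^d$ with $\mathbb{E}Q(x)=x$ and $\mathbb{E}\|Q(x)\|^2=\omega\|x\|^2$ for all $x\in\mathbb{R}^d$. $h:\mathbb{R}^d\to\mathbb{R}\cup\{+\infty\}$ is proper, lower semicontinuous, convex; $F:\mathbb{R}^d\to\mathbb{R}^d$; $\mathcal Z\subseteq\mathbb{R}^d$ is nonempty, closed, convex, with $\mathrm{dom}\,h\subseteq\mathcal Z$; $\tau\in[0,1)$. $z^*\in\mathcal Z$ is a solution of the variational inequality $\langle F(z^* ),z-z^*\rangle+h(z)-h(z^* )\ge0$ for all $z\in\mathcal Z$. $\mathrm{prox}_{\gamma h}(z)=\arg\min_x\{\gamma h(x)+\frac12\|z-x\|^2\}$. Strongly monotone case: there are $\mu_F,\mu_h\ge0$ with $\mu_F+\mu_h>0$ such that for all $z_1,z_2\in\mathcal Z$: $\langle F(z_1)-F(z_2),z_1-z_2\rangle\ge\mu_F\|z_1-z_2\|^2$ and $h(z_1)-h(z_2)-\langle\nabla h(z_2),z_1-z_2\rangle\ge\frac{\mu_h}{2}\|z_1-z_2\|^2$ ($\nabla h$ denotes a subgradient). Monotone case: the same with $\mu_F=\mu_h=0$. $\mathrm{Gap}(z)=\max_{u\in\mathcal C}[\langle F(u),z-u\rangle+h(z)-h(u)]$, where $\mathcal C$ is a compact subset of $\mathcal Z$ containing $z^*$. $z^0$ is deterministic, $K\ge1$, and all random choices (including the randomness of each application of $Q$)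 are made independently of everything generated before them. *)

theory Defs
  imports "HOL-Probability.Probability"
begin

definition effective_domain :: "('a \<Rightarrow> ereal) \<Rightarrow> 'a set" where
  "effective_domain h = {x. h x < \<infinity>}"

definition proper :: "('a \<Rightarrow> ereal) \<Rightarrow> bool" where
  "proper h \<longleftrightarrow> (\<forall>x. h x \<noteq> -\<infinity>) \<and> effective_domain h \<noteq> {}"

definition lower_semicontinuous :: "('a::topological_space \<Rightarrow> ereal) \<Rightarrow> bool" where
  "lower_semicontinuous h \<longleftrightarrow> (\<forall>x. h x \<le> Liminf (at x) h)"

(* The library's convex_on does not cover ereal-valued functions.
   In ereal, 0 * \<infinity> = 0, so the end points t = 0, 1 impose nothing. *)
definition convex_ereal :: "('a::real_vector \<Rightarrow> ereal) \<Rightarrow> bool" where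
  "convex_ereal h \<longleftrightarrow> (\<forall>x y. \<forall>t\<in>{0..1::real}.
     h ((1 - t) *\<^sub>R x + t *\<^sub>R y) \<le> ereal (1 - t) * h x + ereal t * h y)"

(* For proper h this is empty at every point where h is \<infinity>. *)
definition subdifferential :: "('a::real_inner \<Rightarrow> ereal) \<Rightarrow> 'a \<Rightarrow> 'a set" where
  "subdifferential h x = {g. \<forall>y. h x + ereal (g \<bullet> (y - x)) \<le> h y}"

definition prox :: "real \<Rightarrow> ('a::real_normed_vector \<Rightarrow> ereal) \<Rightarrow> 'a \<Rightarrow> 'a" where
  "prox \<gamma> h z = arg_min (\<lambda>x. ereal \<gamma> * h x + ereal ((norm (z - x))\<^sup>2 / 2)) (\<lambda>_. True)"

(* h zs = \<infinity> is impossible for a solution when h is proper with effective_domain h \<subseteq> Z: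
   the left-hand side would be -\<infinity> at every z in effective_domain h. *)
definition vi_solution ::
  "('a::real_inner \<Rightarrow> 'a) \<Rightarrow> ('a \<Rightarrow> ereal) \<Rightarrow> 'a set \<Rightarrow> 'a \<Rightarrow> bool" where
  "vi_solution F h Z zs \<longleftrightarrow>
     zs \<in> Z \<and> (\<forall>z\<in>Z. ereal (F zs \<bullet> (z - zs)) + h z - h zs \<ge> 0)"

(* The second condition is required of every subgradient of h at z2. *)
definition strongly_monotone_problem ::
  "('a::real_inner \<Rightarrow> 'a) \<Rightarrow> ('a \<Rightarrow> ereal) \<Rightarrow> 'a set \<Rightarrow> real \<Rightarrow> real \<Rightarrow> bool" where
  "strongly_monotone_problem F h Z \<mu>F \<mu>h \<longleftrightarrow>
     (\<forall>z1\<in>Z. \<forall>z2\<in>Z. (F z1 - F z2) \<bullet> (z1 - z2) \<ge> \<mu>F * (norm (z1 - z2))\<^sup>2) \<and>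
     (\<forall>z1\<in>Z. \<forall>z2\<in>Z. \<forall>g\<in>subdifferential h z2.
        h z1 - h z2 - ereal (g \<bullet> (z1 - z2)) \<ge> ereal (\<mu>h / 2 * (norm (z1 - z2))\<^sup>2))"

definition boundedly_lipschitz ::
  "('a::real_normed_vector \<Rightarrow> 'a) \<Rightarrow> 'a set \<Rightarrow> real \<Rightarrow> real \<Rightarrow> bool" where
  "boundedly_lipschitz F Z L D \<longleftrightarrow> 0 \<le> L \<and> 0 \<le> D \<and>
     (\<forall>z1\<in>Z. \<forall>z2\<in>Z. (norm (F z1 - F z2))\<^sup>2 \<le> L\<^sup>2 * (norm (z1 - z2))\<^sup>2 + D\<^sup>2)"

(* Since F need not be continuous, the maximum over C is read as a supremum. *)
definition Gap ::
  "('a::real_inner \<Rightarrow> 'a) \<Rightarrow> ('a \<Rightarrow> ereal) \<Rightarrow> 'a set \<Rightarrow> 'a \<Rightarrow> ereal" where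
  "Gap F h C z = (SUP u\<in>C. ereal (F u \<bullet> (z - u)) + h z - h u)"

(* The random map Q is represented as x \<mapsto> Q s x with a random seed s of law S. *)
definition quantization ::
  "'s measure \<Rightarrow> ('s \<Rightarrow> 'a::euclidean_space \<Rightarrow> 'a) \<Rightarrow> real \<Rightarrow> bool" where
  "quantization S Q \<omega> \<longleftrightarrow> prob_space S \<and>
     (\<lambda>(s, x). Q s x) \<in> borel_measurable (S \<Otimes>\<^sub>M borel) \<and>
     (\<forall>x. integrable S (\<lambda>s. Q s x) \<and> (\<integral>s. Q s x \<partial>S) = x) \<and>
     (\<forall>x. integrable S (\<lambda>s. (norm (Q s x))\<^sup>2) \<and>
          (\<integral>s. (norm (Q s x))\<^sup>2 \<partial>S) = \<omega> * (norm x)\<^sup>2)"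

(* One sample path: s k is the seed of the k-th application of Q, and the coin b k
   decides whether w is updated at step k. *)
definition quant_ES ::
  "('a::real_normed_vector \<Rightarrow> ereal) \<Rightarrow> ('a \<Rightarrow> 'a) \<Rightarrow> ('s \<Rightarrow> 'a \<Rightarrow> 'a) \<Rightarrow> real \<Rightarrow> real \<Rightarrow>
   nat \<Rightarrow> 'a \<Rightarrow> (nat \<Rightarrow> 's) \<Rightarrow> (nat \<Rightarrow> bool) \<Rightarrow>
   (nat \<Rightarrow> 'a) \<Rightarrow> (nat \<Rightarrow> 'a) \<Rightarrow> (nat \<Rightarrow> 'a) \<Rightarrow> bool" where
  "quant_ES h F Q \<gamma> \<tau> K z0 s b z zhalf w \<longleftrightarrow>
     z 0 = z0 \<and> w 0 = z0 \<and>
     (\<forall>k<K. let zbar = \<tau> *\<^sub>R z k + (1 - \<tau>) *\<^sub>R w k in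
        zhalf k = prox \<gamma> h (zbar - \<gamma> *\<^sub>R F (w k)) \<and>
        z (Suc k) = prox \<gamma> h
          (zbar - \<gamma> *\<^sub>R Q (s k) (F (zhalf k) - F (w k)) - \<gamma> *\<^sub>R F (w k)) \<and>
        w (Suc k) = (if b k then z (Suc k) else w k))"

(* The seeds have law S, the coins are True with probability 1 - \<tau>, and all of
   s 0, b 0, s 1, b 1, ..., s (K-1), b (K-1) are mutually independent, i.e. each of them
   is independent of those before it: the pairs are independent of each other, and
   each pair has the product law. *)
definition independent_choices ::
  "'m measure \<Rightarrow> 's measure \<Rightarrow> real \<Rightarrow> nat \<Rightarrow>
   (nat \<Rightarrow> 'm \<Rightarrow> 's) \<Rightarrow> (nat \<Rightarrow> 'm \<Rightarrow> bool) \<Rightarrow> bool" where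
  "independent_choices M S \<tau> K s b \<longleftrightarrow>
     (let N = S \<Otimes>\<^sub>M measure_pmf (bernoulli_pmf (1 - \<tau>));
          X = (\<lambda>k x. (s k x, b k x))
      in prob_space.indep_vars M (\<lambda>_. N) X {..<K} \<and> (\<forall>k<K. distr M N (X k) = N))"

end

theory Submission
  imports Defs
begin

text \<open>
  Adding the subgradient inequalities of the two proximal steps bounds the distance of
  \<open>z\<^sup>k\<^sup>+\<^sup>1\<close> to any \<open>u\<close> by a \<open>\<tau>\<close>-weighted average of the distances of \<open>z\<^sup>k\<close> and \<open>w\<^sup>k\<close>,
  minus the squared lengths of the steps taken, plus the inner product of the quantized difference
  with \<open>z\<^sup>k\<^sup>+\<^sup>1\<^sup>/\<^sup>2 - z\<^sup>k\<^sup>+\<^sup>1\<close>. Averaging over the coin turns this into a descent inequality for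
  \<open>\<tau> |z\<^sup>k - u|\<^sup>2 + |w\<^sup>k - u|\<^sup>2\<close>; the quantization is unbiased given the past and its variance is
  absorbed by the step lengths, up to \<open>\<omega> D\<^sup>2\<close>.

  For \<open>u = z\<^sup>*\<close> strong monotonicity makes the inequality contractive: \<open>- F z\<^sup>*\<close> is a
  subgradient of \<open>h\<close> at \<open>z\<^sup>*\<close>, so the modulus of \<open>h\<close> contributes as well.
  For the gap, \<open>u\<close> is chosen after the randomness, so the noise cannot be averaged out for fixed
  \<open>u\<close>. It enters only through an inner product of \<open>u - z\<^sup>0\<close> with a sum of martingale
  differences, whose second moment is the sum of the second moments.
\<close>

section \<open>Proper lower semicontinuous convex functions\<close>

text \<open>Each step draws a seed and a coin, and the two are averaged against different
  information: the seed with everything before the step frozen, the coin with the seed frozen as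
  well. Product laws with Fubini, and factorisation of expectations, take the place of conditioning.
  The weights \<tau> and 1 of the potential make the coin average exact: the new \<open>w\<close>
  contributes 1 - \<tau> times the squared distance of the new \<open>z\<close>, which completes
  \<tau> to 1. For the gap, where \<open>u\<close> depends on the outcome, the coin is a noise of
  its own. Its second moment is governed by the squared distance from \<open>w\<close> to the new
  \<open>z\<close>, not by D^2, so it must be paid for by the same step lengths that absorb the
  quantization variance. Hence only half of the last step length is spent on the variance, and the
  accumulated noise is weighted by 1/32, just small enough for the other half. The constants reached
  (rate 1/4 with exponent \<open>K\<close>; 5 and 9/8 for the gap) are sharper than the claimed
  ones; the slack is given away at the end.\<close>

lemma norm_sum_square_le:
  fixes x y :: "'a::real_inner"
  shows "(norm (x + y))\<^sup>2 \<le> 2 * (norm x)\<^sup>2 + 2 * (norm y)\<^sup>2"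
proof -
  have "0 \<le> (norm (x - y))\<^sup>2" by simp
  then show ?thesis
    unfolding power2_norm_eq_inner by (simp add: inner_diff inner_add inner_commute)
qed

lemma two_inner_le_weighted:
  fixes x y :: "'a::real_inner"
  assumes "0 < a"
  shows "2 * (x \<bullet> y) \<le> (norm x)\<^sup>2 / a + a * (norm y)\<^sup>2"
proof -
  have "0 \<le> (norm (x - a *\<^sub>R y))\<^sup>2 / a" using assms by simp
  also have "\<dots> = (norm x)\<^sup>2 / a + a * (norm y)\<^sup>2 - 2 * (x \<bullet> y)"
    unfolding power2_norm_eq_inner using assms
    by (simp add: inner_diff inner_commute field_simps)
  finally show ?thesis by simp
qed

lemma norm_diff_triangle_square:
  fixes x y z :: "'a::real_inner"
  shows "(norm (x - z))\<^sup>2 \<le> 2 * (norm (x - y))\<^sup>2 + 2 * (norm (y - z))\<^sup>2"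
  using norm_sum_square_le[of "x - y" "y - z"] by simp

text \<open>The quotient is taken in \<open>ereal\<close>, where dividing the positive root by 0
  gives infinity: for \<open>L * sqrt c = 0\<close> it sets no limit on \<gamma>, and the left-hand
  side of the conclusion is 0. Otherwise the denominator is cleared and both sides are
  squared.\<close>

lemma step_size_square:
  assumes "0 < \<gamma>" "\<tau> < 1" "0 \<le> L" "0 \<le> c"
    and "ereal \<gamma> \<le> ereal (sqrt (1 - \<tau>)) / ereal (2 * L * sqrt c)"
  shows "4 * \<gamma>\<^sup>2 * L\<^sup>2 * c \<le> 1 - \<tau>"
proof (cases "L * sqrt c = 0")
  case True
  then show ?thesis using assms by auto
next
  case False
  then have pos: "0 < 2 * L * sqrt c" using assms by (simp add: less_le)
  then have "\<gamma> \<le> sqrt (1 - \<tau>) / (2 * L * sqrt c)"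
    using assms(5) by (auto simp: ereal_divide split: if_splits)
  then have "\<gamma> * (2 * L * sqrt c) \<le> sqrt (1 - \<tau>)" using pos by (simp only: pos_le_divide_eq)
  then have "(\<gamma> * (2 * L * sqrt c))\<^sup>2 \<le> (sqrt (1 - \<tau>))\<^sup>2"
    using pos assms(1) by (intro power_mono) auto
  then show ?thesis using assms by (simp add: power_mult_distrib)
qed

text \<open>\<open>Liminf (at x)\<close> sees only a punctured neighbourhood. The value at
  \<open>x\<close> itself exceeds \<open>c\<close> by the choice of \<open>x\<close>, which fills
  the hole.\<close>

lemma open_lower_semicontinuous:
  fixes h :: "'a::metric_space \<Rightarrow> ereal"
  assumes "lower_semicontinuous h"
  shows "open {x. c < h x}"
proof (rule openI)
  fix x assume "x \<in> {x. c < h x}"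
  then have c: "c < h x" by simp
  with assms have "\<forall>\<^sub>F y in at x. c < h y"
    unfolding lower_semicontinuous_def le_Liminf_iff by blast
  then have "\<forall>\<^sub>F y in nhds x. c < h y"
    using c by (auto simp: eventually_at_filter elim: eventually_mono)
  then show "\<exists>e>0. ball x e \<subseteq> {x. c < h x}"
    by (auto simp: eventually_nhds_metric dist_commute subset_iff)
qed

text \<open>If there were no minimiser, the sets where \<open>G\<close> exceeds one of its values on
  \<open>T\<close> would cover \<open>T\<close>; in a finite subcover the index with the smallest
  value is left uncovered. Openness is asked only at the levels that occur in this cover.\<close>

lemma lower_semicontinuous_attains_inf:
  fixes G :: "'a::topological_space \<Rightarrow> 'b::linorder"
  assumes G: "\<And>c. c \<in> G ` T \<Longrightarrow> open {x. c < G x}" and T: "compact T" "T \<noteq> {}"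
  shows "\<exists>x\<in>T. \<forall>y\<in>T. G x \<le> G y"
proof (rule ccontr)
  assume "\<not> ?thesis"
  then have "T \<subseteq> (\<Union>y\<in>T. {x. G y < G x})" by (force simp: not_le)
  with compactE_image[OF T(1), of T "\<lambda>y. {x. G y < G x}"] G
  obtain I where I: "I \<subseteq> T" "finite I" "T \<subseteq> (\<Union>y\<in>I. {x. G y < G x})" by blast
  with T(2) have "I \<noteq> {}" by auto
  then obtain y where y: "y \<in> I" "\<And>x. x \<in> I \<Longrightarrow> G y \<le> G x"
    using I(2) ex_min_if_finite[of "G ` I"] by (auto simp: not_less)
  with I obtain x where "x \<in> I" "G x < G y" by blast
  with y(2) show False by force
qed

locale proper_lsc_convex =
  fixes h :: "'a::euclidean_space \<Rightarrow> ereal"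
  assumes proper: "proper h" and lsc: "lower_semicontinuous h" and conv: "convex_ereal h"
begin

lemma not_MInfty: "h x \<noteq> -\<infinity>"
  using proper by (simp add: proper_def)

text \<open>A real-valued copy of \<open>h\<close> for arithmetic. Outside \<open>dom_h\<close> it
  takes the default value 0, so facts about it carry domain membership.\<close>

definition hr :: "'a \<Rightarrow> real" where "hr x = real_of_ereal (h x)"

abbreviation "dom_h \<equiv> effective_domain h"

lemma h_eq: "x \<in> dom_h \<Longrightarrow> h x = ereal (hr x)"
  using not_MInfty[of x] by (auto simp: effective_domain_def hr_def ereal_real)

lemma h_notin: "x \<notin> dom_h \<Longrightarrow> h x = \<infinity>"
  by (simp add: effective_domain_def)

lemma hr_convex:
  assumes "x \<in> dom_h" "y \<in> dom_h" "0 \<le> t" "t \<le> 1"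
  shows "(1 - t) *\<^sub>R x + t *\<^sub>R y \<in> dom_h"
    and "hr ((1 - t) *\<^sub>R x + t *\<^sub>R y) \<le> (1 - t) * hr x + t * hr y"
proof -
  have le: "h ((1 - t) *\<^sub>R x + t *\<^sub>R y) \<le> ereal ((1 - t) * hr x + t * hr y)"
    using conv[unfolded convex_ereal_def, rule_format, of t x y] assms by (simp add: h_eq)
  then show d: "(1 - t) *\<^sub>R x + t *\<^sub>R y \<in> dom_h"
    by (auto simp: effective_domain_def intro: le_less_trans)
  show "hr ((1 - t) *\<^sub>R x + t *\<^sub>R y) \<le> (1 - t) * hr x + t * hr y"
    using le by (simp add: h_eq[OF d])
qed

lemma convex_on_hr: "convex_on dom_h hr"
proof (rule convex_onI)
  show "convex dom_h"
    unfolding convex_alt using hr_convex(1) by blast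
qed (use hr_convex(2) in auto)

text \<open>A convex function bounded below near a domain point can fall at most linearly. Let
  \<open>p\<close> minimise \<open>h\<close> on the unit ball around \<open>x0\<close>. For
  \<open>x\<close> beyond the ball, the segment from \<open>x0\<close> to \<open>x\<close> leaves it
  at a point of value at least \<open>hr p\<close>, and convexity extrapolates this to
  \<open>x\<close> with slope \<open>c\<close>. The centre \<open>y\<close> is free because the
  triangle inequality changes only the offset.\<close>

lemma lower_bound:
  obtains A B where "0 \<le> B" "\<And>x. ereal (A - B * norm (x - y)) \<le> h x"
proof -
  obtain x0 where x0: "x0 \<in> dom_h" using proper by (auto simp: proper_def)
  obtain p where p: "\<And>x. x \<in> cball x0 1 \<Longrightarrow> h p \<le> h x"
    using lower_semicontinuous_attains_inf[of h "cball x0 1"] open_lower_semicontinuous[OF lsc] by force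
  have "h p \<le> h x0" using p by simp
  then have "p \<in> dom_h" using x0 by (auto simp: effective_domain_def)
  define c where "c = hr x0 - hr p"
  have c: "0 \<le> c" using p[of x0] x0 \<open>p \<in> dom_h\<close> by (simp add: c_def h_eq)
  have b: "hr x0 - c - c * norm (x - x0) \<le> hr x" if x: "x \<in> dom_h" for x
  proof (cases "norm (x - x0) \<le> 1")
    case True
    then have "hr p \<le> hr x"
      using p[of x] x \<open>p \<in> dom_h\<close> by (simp add: h_eq dist_norm norm_minus_commute)
    moreover have "0 \<le> c * norm (x - x0)" using c by simp
    ultimately show ?thesis by (simp add: c_def)
  next
    case False
    define r where "r = norm (x - x0)"
    have r: "r > 1" using False by (simp add: r_def)
    \<comment> \<open>The point at distance 1 from \<open>x0\<close> on the way to
      \<open>x\<close>.\<close>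
    let ?q = "(1 - 1/r) *\<^sub>R x0 + (1/r) *\<^sub>R x"
    have "?q - x0 = (1/r) *\<^sub>R (x - x0)" by (simp add: algebra_simps)
    then have "norm (?q - x0) = 1" using r by (auto simp: r_def)
    then have "?q \<in> cball x0 1" by (simp add: dist_norm norm_minus_commute)
    then have "hr p \<le> hr ?q"
      using p[of ?q] hr_convex(1)[OF x0 x, of "1/r"] r \<open>p \<in> dom_h\<close> by (simp add: h_eq)
    also have "\<dots> \<le> (1 - 1/r) * hr x0 + (1/r) * hr x"
      using hr_convex(2)[OF x0 x, of "1/r"] r by simp
    finally have "r * hr p \<le> r * ((1 - 1/r) * hr x0 + (1/r) * hr x)"
      using r by (intro mult_left_mono) auto
    also have "\<dots> = (r - 1) * hr x0 + hr x" using r by (simp add: field_simps)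
    finally have "hr x0 - r * c \<le> hr x" by (simp add: c_def algebra_simps)
    then show ?thesis using c by (simp add: r_def mult.commute)
  qed
  show ?thesis
  proof (rule that[of c "hr x0 - c - c * norm (y - x0)"])
    fix x
    have "norm (x - x0) \<le> norm (x - y) + norm (y - x0)"
      using norm_triangle_ineq[of "x - y" "y - x0"] by simp
    then have "c * norm (x - x0) \<le> c * norm (x - y) + c * norm (y - x0)"
      using c by (metis distrib_left mult_left_mono)
    then show "ereal (hr x0 - c - c * norm (y - x0) - c * norm (x - y)) \<le> h x"
      using b[of x] by (cases "x \<in> dom_h") (auto simp: h_eq h_notin)
  qed fact
qed

section \<open>Proximal points: existence, optimality, nonexpansiveness, the extragradient
  inequality\<close>

lemma prox_objective_minimum:
  assumes \<gamma>: "0 < \<gamma>"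
  shows "\<exists>p. \<forall>x. ereal \<gamma> * h p + ereal ((norm (y - p))\<^sup>2 / 2)
      \<le> ereal \<gamma> * h x + ereal ((norm (y - x))\<^sup>2 / 2)"
proof -
  define G where "G x = ereal \<gamma> * h x + ereal ((norm (y - x))\<^sup>2 / 2)" for x
  have G_open: "open {x. c < G x}" if "c \<in> range G" for c
  proof (cases c)
    case (real c')
    \<comment> \<open>The sum exceeds \<open>c'\<close> exactly when both summands strictly exceed
      shares \<open>a\<close> and \<open>d\<close> with \<open>c' \<le> \<gamma> * a + d\<close>;
      this makes the superlevel set a union of open sets. For a finite value the excess \<delta> is
      shared evenly; for an infinite one \<open>d\<close> lies 1 below the quadratic and
      \<open>a\<close> takes up the rest.\<close>
    have "\<exists>a d. ereal a < h x \<and> d < (norm (y - x))\<^sup>2 / 2 \<and> c' \<le> \<gamma> * a + d" if "c < G x" for x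
    proof (cases "h x")
      case (real r)
      define \<delta> where "\<delta> = \<gamma> * r + (norm (y - x))\<^sup>2 / 2 - c'"
      have \<delta>: "\<delta> > 0" using that real \<open>c = ereal c'\<close> by (simp add: G_def \<delta>_def)
      show ?thesis
        by (rule exI[of _ "r - \<delta>/(2*\<gamma>)"], rule exI[of _ "(norm (y - x))\<^sup>2 / 2 - \<delta>/2"])
          (use \<delta> \<gamma> real in \<open>auto simp: \<delta>_def field_simps\<close>)
    next
      case PInf
      show ?thesis
        by (rule exI[of _ "(c' - ((norm (y - x))\<^sup>2 / 2 - 1))/\<gamma>"], rule exI[of _ "(norm (y - x))\<^sup>2 / 2 - 1"])
          (use \<gamma> PInf in \<open>auto simp: field_simps\<close>)
    qed (use not_MInfty in auto)
    moreover have "c < G x" if "ereal a < h x" "d < (norm (y - x))\<^sup>2 / 2" "c' \<le> \<gamma> * a + d" for x a d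
    proof (cases "h x")
      case (real r)
      have "\<gamma> * a < \<gamma> * r" using that(1) \<gamma> real by simp
      then show ?thesis using that real \<open>c = ereal c'\<close> by (simp add: G_def)
    qed (use that \<open>c = ereal c'\<close> \<gamma> not_MInfty in \<open>auto simp: G_def\<close>)
    ultimately have "{x. c < G x} = (\<Union>(a, d)\<in>{(a, d). c' \<le> \<gamma> * a + d}.
        {x. ereal a < h x} \<inter> {x. d < (norm (y - x))\<^sup>2 / 2})"
      by (auto, blast)
    also have "open \<dots>"
      by (intro open_UN) (auto intro!: open_Int open_lower_semicontinuous[OF lsc]
          open_Collect_less continuous_intros)
    finally show ?thesis .
  next
    case MInf
    then obtain x where "G x = -\<infinity>" using \<open>c \<in> range G\<close> by (metis rangeE)
    then show ?thesis using not_MInfty[of x] \<gamma> by (cases "h x") (auto simp: G_def)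
  qed auto
  obtain x0 where x0: "x0 \<in> dom_h" using proper by (auto simp: proper_def)
  obtain A B where AB: "0 \<le> B" "\<And>x. ereal (A - B * norm (x - y)) \<le> h x"
    using lower_bound by blast
  define g0 where "g0 = \<gamma> * hr x0 + (norm (y - x0))\<^sup>2 / 2"
  have g0: "G x0 = ereal g0" using x0 by (simp add: G_def g0_def h_eq)
  \<comment> \<open>Outside this radius the quadratic outweighs the norm-linear minorant:
    \<open>d / 2 - \<gamma> * B\<close> is at least 1 and \<open>d\<close> at least
    \<open>g0 - \<gamma> * A\<close>, so the objective is at least its value \<open>g0\<close> at
    \<open>x0\<close>. The first entry keeps \<open>x0\<close> in the ball.\<close>
  define R where "R = max (norm (x0 - y)) (max (2 * (\<gamma> * B + 1)) \<bar>g0 - \<gamma> * A\<bar>)"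
  have "0 \<le> R" unfolding R_def by (meson max.coboundedI1 norm_ge_zero)
  then obtain p where p: "p \<in> cball y R" "\<And>x. x \<in> cball y R \<Longrightarrow> G p \<le> G x"
    using lower_semicontinuous_attains_inf[of G "cball y R"] G_open by force
  have px0: "G p \<le> G x0"
    by (rule p) (auto simp: R_def dist_norm norm_minus_commute)
  have "G p \<le> G x" for x
  proof (cases "x \<in> cball y R")
    case False
    define d where "d = norm (x - y)"
    have d: "d \<ge> 2 * (\<gamma> * B + 1)" "d \<ge> \<bar>g0 - \<gamma> * A\<bar>" "d \<ge> 0"
      using False by (auto simp: R_def d_def dist_norm norm_minus_commute)
    have "d * 1 \<le> d * (d / 2 - \<gamma> * B)" using d by (intro mult_left_mono) (auto simp: field_simps)
    then have "g0 \<le> \<gamma> * (A - B * d) + d\<^sup>2 / 2"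
      using d(2) by (simp add: field_simps power2_eq_square)
    moreover have "\<gamma> * (A - B * d) \<le> \<gamma> * hr x" if "x \<in> dom_h"
      using AB(2)[of x] \<gamma> that by (simp add: d_def h_eq)
    ultimately have "g0 \<le> \<gamma> * hr x + d\<^sup>2 / 2" if "x \<in> dom_h"
      using that by linarith
    then have "ereal g0 \<le> G x"
      by (cases "x \<in> dom_h") (use \<gamma> in \<open>auto simp: G_def d_def norm_minus_commute h_eq h_notin\<close>)
    with px0 show ?thesis by (simp add: g0)
  qed (rule p)
  then show ?thesis by (auto simp: G_def)
qed

lemma prox_minimizes:
  assumes \<gamma>: "0 < \<gamma>"
  shows "ereal \<gamma> * h (prox \<gamma> h y) + ereal ((norm (y - prox \<gamma> h y))\<^sup>2 / 2)
      \<le> ereal \<gamma> * h x + ereal ((norm (y - x))\<^sup>2 / 2)"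
  using someI_ex[OF prox_objective_minimum[OF \<gamma>, of y]]
  unfolding prox_def arg_min_def is_arg_min_linorder by simp

lemma prox_in_dom:
  assumes \<gamma>: "0 < \<gamma>"
  shows "prox \<gamma> h y \<in> dom_h"
proof -
  obtain x0 where x0: "x0 \<in> dom_h" using proper by (auto simp: proper_def)
  have "ereal \<gamma> * h (prox \<gamma> h y) + ereal ((norm (y - prox \<gamma> h y))\<^sup>2 / 2) < \<infinity>"
    using prox_minimizes[OF \<gamma>, of y x0] by (rule le_less_trans) (simp add: h_eq[OF x0])
  then show ?thesis using \<gamma> by (cases "h (prox \<gamma> h y)") (auto simp: effective_domain_def)
qed

lemma subdifferential_iff:
  assumes "p \<in> dom_h"
  shows "g \<in> subdifferential h p \<longleftrightarrow> (\<forall>q\<in>dom_h. hr p + g \<bullet> (q - p) \<le> hr q)"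
proof -
  have "h p + ereal (g \<bullet> (q - p)) \<le> h q \<longleftrightarrow> (q \<in> dom_h \<longrightarrow> hr p + g \<bullet> (q - p) \<le> hr q)" for q
    by (cases "q \<in> dom_h") (simp_all add: assms h_eq h_notin)
  then show ?thesis by (auto simp: subdifferential_def)
qed

text \<open>Moving from the minimiser towards \<open>q\<close> by a fraction \<open>t\<close> cannot
  lower the objective. After division by \<open>t\<close> the quadratic leaves an error of order
  \<open>t\<close>, which vanishes as \<open>t\<close> tends to 0.\<close>

lemma prox_subgradient:
  assumes \<gamma>: "0 < \<gamma>"
  shows "(1 / \<gamma>) *\<^sub>R (y - prox \<gamma> h y) \<in> subdifferential h (prox \<gamma> h y)"
  unfolding subdifferential_iff[OF prox_in_dom[OF \<gamma>]]
proof
  fix q assume q: "q \<in> dom_h"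
  define p where "p = prox \<gamma> h y"
  have p: "p \<in> dom_h" using prox_in_dom[OF \<gamma>] by (simp add: p_def)
  have *: "\<gamma> * hr p + (y - p) \<bullet> (q - p) - t / 2 * (norm (q - p))\<^sup>2 \<le> \<gamma> * hr q" if t: "0 < t" "t \<le> 1" for t
  proof -
    let ?x = "(1 - t) *\<^sub>R p + t *\<^sub>R q"
    have x: "y - ?x = (y - p) - t *\<^sub>R (q - p)" by (simp add: algebra_simps)
    have "\<gamma> * hr p + (norm (y - p))\<^sup>2 / 2 \<le> \<gamma> * hr ?x + (norm (y - ?x))\<^sup>2 / 2"
      using prox_minimizes[OF \<gamma>, of y ?x] hr_convex(1)[OF p q, of t] t p by (simp add: p_def[symmetric] h_eq)
    also have "\<gamma> * hr ?x \<le> \<gamma> * ((1 - t) * hr p + t * hr q)"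
      using hr_convex(2)[OF p q, of t] t \<gamma> by (intro mult_left_mono) auto
    also have "(norm (y - ?x))\<^sup>2 = (norm (y - p))\<^sup>2 - 2 * t * ((y - p) \<bullet> (q - p)) + t\<^sup>2 * (norm (q - p))\<^sup>2"
      unfolding x power2_norm_eq_inner by (simp add: inner_diff power2_eq_square inner_commute algebra_simps)
    finally have "t * (\<gamma> * hr p + (y - p) \<bullet> (q - p) - t / 2 * (norm (q - p))\<^sup>2) \<le> t * (\<gamma> * hr q)"
      by (simp add: field_simps power2_eq_square)
    then show ?thesis using t by simp
  qed
  have "\<gamma> * hr p + (y - p) \<bullet> (q - p) \<le> \<gamma> * hr q"
  proof (rule tendsto_upperbound)
    show "((\<lambda>t. \<gamma> * hr p + (y - p) \<bullet> (q - p) - t / 2 * (norm (q - p))\<^sup>2) \<longlongrightarrow> \<gamma> * hr p + (y - p) \<bullet> (q - p)) (at_right 0)"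
      by (auto intro!: tendsto_eq_intros)
    show "\<forall>\<^sub>F t in at_right 0. \<gamma> * hr p + (y - p) \<bullet> (q - p) - t / 2 * (norm (q - p))\<^sup>2 \<le> \<gamma> * hr q"
      unfolding eventually_at_right_field using * by (intro exI[of _ 1]) auto
  qed auto
  then show "hr (prox \<gamma> h y) + (1 / \<gamma>) *\<^sub>R (y - prox \<gamma> h y) \<bullet> (q - prox \<gamma> h y) \<le> hr q"
    using \<gamma> unfolding p_def[symmetric] inner_scaleR_left by (simp add: field_simps)
qed

text \<open>Testing each of the two subgradient inequalities at the other point cancels
  \<open>hr\<close> and gives firm nonexpansiveness; Cauchy-Schwarz does the rest. Continuity then
  serves the measurability of the iterates, the Lipschitz bound their square integrability.\<close>

lemma prox_nonexpansive:
  assumes \<gamma>: "0 < \<gamma>"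
  shows "norm (prox \<gamma> h x - prox \<gamma> h y) \<le> norm (x - y)"
proof -
  let ?p = "prox \<gamma> h x" and ?q = "prox \<gamma> h y"
  note d = prox_in_dom[OF \<gamma>]
  have "(x - ?p) \<bullet> (?q - ?p) / \<gamma> + (y - ?q) \<bullet> (?p - ?q) / \<gamma> \<le> 0"
    using prox_subgradient[OF \<gamma>, of x] prox_subgradient[OF \<gamma>, of y]
    unfolding subdifferential_iff[OF d] using d[of x] d[of y] by force
  then have "(x - ?p) \<bullet> (?q - ?p) + (y - ?q) \<bullet> (?p - ?q) \<le> 0"
    using \<gamma> by (simp add: add_divide_distrib[symmetric] divide_le_0_iff)
  then have "(norm (?p - ?q))\<^sup>2 \<le> (x - y) \<bullet> (?p - ?q)"
    unfolding power2_norm_eq_inner by (simp add: inner_diff inner_commute algebra_simps)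
  also have "\<dots> \<le> norm (x - y) * norm (?p - ?q)" by (rule norm_cauchy_schwarz)
  finally show ?thesis
    by (cases "norm (?p - ?q) = 0") (simp_all add: power2_eq_square)
qed

lemma continuous_on_prox: "0 < \<gamma> \<Longrightarrow> continuous_on A (prox \<gamma> h)"
  by (rule lipschitz_on_continuous_on[of 1], rule lipschitz_onI)
    (auto simp: dist_norm prox_nonexpansive)

lemma borel_measurable_prox: "0 < \<gamma> \<Longrightarrow> prox \<gamma> h \<in> borel_measurable borel"
  by (intro borel_measurable_continuous_onI continuous_on_prox)

lemma borel_measurable_h: "h \<in> borel_measurable borel"
  by (rule borel_measurableI_greater) (auto simp: open_lower_semicontinuous[OF lsc])

text \<open>The modulus of \<open>h\<close> is postulated at every subgradient, so it applies to the
  one that the proximal step provides.\<close>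

lemma prox_strong:
  assumes \<gamma>: "0 < \<gamma>" and mon: "strongly_monotone_problem F h Z \<mu>F \<mu>h"
    and Z: "dom_h \<subseteq> Z" and u: "u \<in> dom_h"
  shows "\<gamma> * hr (prox \<gamma> h y) + (y - prox \<gamma> h y) \<bullet> (u - prox \<gamma> h y)
      + \<gamma> * \<mu>h / 2 * (norm (u - prox \<gamma> h y))\<^sup>2 \<le> \<gamma> * hr u"
proof -
  let ?p = "prox \<gamma> h y"
  have p: "?p \<in> dom_h" by (rule prox_in_dom[OF \<gamma>])
  have "h u - h ?p - ereal ((1 / \<gamma>) *\<^sub>R (y - ?p) \<bullet> (u - ?p)) \<ge> ereal (\<mu>h / 2 * (norm (u - ?p))\<^sup>2)"
    using mon prox_subgradient[OF \<gamma>, of y] p u Z unfolding strongly_monotone_problem_def by blast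
  then have "\<mu>h / 2 * (norm (u - ?p))\<^sup>2 \<le> hr u - hr ?p - (1 / \<gamma>) * ((y - ?p) \<bullet> (u - ?p))"
    using p u by (simp add: h_eq)
  then have "\<gamma> * (\<mu>h / 2 * (norm (u - ?p))\<^sup>2) \<le> \<gamma> * (hr u - hr ?p - (1 / \<gamma>) * ((y - ?p) \<bullet> (u - ?p)))"
    using \<gamma> by (intro mult_left_mono) auto
  then show ?thesis using \<gamma> by (simp add: algebra_simps)
qed

text \<open>The full step is tested at \<open>u\<close> and the half step at \<open>zp\<close>, so
  \<open>hr zp\<close> cancels. Both steps use the same \<open>v\<close>, hence only
  \<open>q\<close> survives against \<open>zh - zp\<close>. In the algorithm \<open>q\<close> is a
  quantized difference of operator values, which the step lengths can absorb.\<close>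

lemma extragradient_step:
  assumes \<gamma>: "0 < \<gamma>" and mon: "strongly_monotone_problem F h Z \<mu>F \<mu>h"
    and Z: "dom_h \<subseteq> Z" and u: "u \<in> dom_h"
    and zh: "zh = prox \<gamma> h (\<tau> *\<^sub>R z + (1 - \<tau>) *\<^sub>R w - \<gamma> *\<^sub>R v)"
    and zp: "zp = prox \<gamma> h (\<tau> *\<^sub>R z + (1 - \<tau>) *\<^sub>R w - \<gamma> *\<^sub>R q - \<gamma> *\<^sub>R v)"
  shows "(norm (zp - u))\<^sup>2 + 2 * \<gamma> * ((q + v) \<bullet> (zh - u)) + 2 * \<gamma> * (hr zh - hr u)
      + \<gamma> * \<mu>h * ((norm (zp - u))\<^sup>2 + (norm (zp - zh))\<^sup>2)
    \<le> \<tau> * (norm (z - u))\<^sup>2 + (1 - \<tau>) * (norm (w - u))\<^sup>2 - \<tau> * (norm (z - zh))\<^sup>2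
      - (1 - \<tau>) * (norm (w - zh))\<^sup>2 - (norm (zp - zh))\<^sup>2 + 2 * \<gamma> * (q \<bullet> (zh - zp))"
proof -
  let ?zb = "\<tau> *\<^sub>R z + (1 - \<tau>) *\<^sub>R w"
  have zp_dom: "zp \<in> dom_h" unfolding zp by (rule prox_in_dom[OF \<gamma>])
  have 1: "\<gamma> * hr zp + (?zb - \<gamma> *\<^sub>R q - \<gamma> *\<^sub>R v - zp) \<bullet> (u - zp) + \<gamma> * \<mu>h / 2 * (norm (u - zp))\<^sup>2 \<le> \<gamma> * hr u"
    unfolding zp by (rule prox_strong[OF \<gamma> mon Z u])
  have 2: "\<gamma> * hr zh + (?zb - \<gamma> *\<^sub>R v - zh) \<bullet> (zp - zh) + \<gamma> * \<mu>h / 2 * (norm (zp - zh))\<^sup>2 \<le> \<gamma> * hr zp"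
    unfolding zh by (rule prox_strong[OF \<gamma> mon Z zp_dom])
  \<comment> \<open>Polarisation. The squared distance from \<open>?zb\<close> to a point is the
    \<tau>-weighted average of those from \<open>z\<close> and \<open>w\<close>, minus a variance
    independent of the point; that variance cancels between \<open>u\<close> and
    \<open>zh\<close>.\<close>
  have 3: "2 * ((?zb - \<gamma> *\<^sub>R q - \<gamma> *\<^sub>R v - zp) \<bullet> (u - zp)) + 2 * ((?zb - \<gamma> *\<^sub>R v - zh) \<bullet> (zp - zh))
     = (norm (zp - u))\<^sup>2 + 2 * \<gamma> * ((q + v) \<bullet> (zh - u)) - (\<tau> * (norm (z - u))\<^sup>2 + (1 - \<tau>) * (norm (w - u))\<^sup>2 - \<tau> * (norm (z - zh))\<^sup>2
      - (1 - \<tau>) * (norm (w - zh))\<^sup>2 - (norm (zp - zh))\<^sup>2 + 2 * \<gamma> * (q \<bullet> (zh - zp)))"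
    unfolding power2_norm_eq_inner
    by (simp add: inner_diff_left inner_diff_right inner_add_left inner_add_right inner_commute algebra_simps)
  show ?thesis
    using 1 2 3 unfolding norm_minus_commute[of u zp] by (simp add: algebra_simps)
qed

section \<open>The solution as a domain point, and regularity of the gap\<close>

lemma vi_solution_subgradient:
  assumes zs: "vi_solution F h Z zs" and Z: "dom_h \<subseteq> Z"
  shows "zs \<in> dom_h" and "- F zs \<in> subdifferential h zs"
proof -
  obtain x0 where x0: "x0 \<in> dom_h" using proper by (auto simp: proper_def)
  have vi: "0 \<le> ereal (F zs \<bullet> (y - zs)) + h y - h zs" if "y \<in> dom_h" for y
    using zs subsetD[OF Z that] unfolding vi_solution_def by blast
  show d: "zs \<in> dom_h"
  proof (rule ccontr)
    assume "zs \<notin> dom_h"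
    then show False using vi[OF x0] by (simp add: h_eq[OF x0] h_notin)
  qed
  show "- F zs \<in> subdifferential h zs"
    unfolding subdifferential_iff[OF d]
  proof
    fix q assume q: "q \<in> dom_h"
    then show "hr zs + (- F zs) \<bullet> (q - zs) \<le> hr q"
      using vi[OF q] by (simp add: h_eq[OF q] h_eq[OF d])
  qed
qed

text \<open>\<open>Gap\<close> without its term \<open>h p\<close>. What remains is a supremum of
  affine functions of \<open>p\<close> with bounded slopes, hence Lipschitz; this settles
  measurability even for uncountable \<open>C\<close>. Points outside \<open>dom_h\<close>
  contribute only -\<infinity> to \<open>Gap\<close> and are left out to stay in the reals.\<close>

definition gap_sup :: "('a \<Rightarrow> 'a) \<Rightarrow> 'a set \<Rightarrow> 'a \<Rightarrow> real" where
  "gap_sup F C p = (SUP u\<in>C \<inter> dom_h. F u \<bullet> (p - u) - hr u)"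

context
  fixes F :: "'a \<Rightarrow> 'a" and C :: "'a set" and B :: real
  assumes FB: "\<And>u. u \<in> C \<Longrightarrow> norm (F u) \<le> B" and C: "bounded C" "C \<inter> dom_h \<noteq> {}"
begin

text \<open>On the bounded set \<open>C\<close> the norm-linear minorant of \<open>h\<close> bounds
  \<open>- hr u\<close> from above, and Cauchy-Schwarz bounds the inner product.\<close>

lemma gap_sup_bdd: "bdd_above ((\<lambda>u. F u \<bullet> (p - u) - hr u) ` (C \<inter> dom_h))"
proof -
  obtain A A' where A: "0 \<le> A'" "\<And>x. ereal (A - A' * norm (x - p)) \<le> h x"
    using lower_bound by blast
  obtain R where R: "\<And>u. u \<in> C \<Longrightarrow> norm (u - p) \<le> R"
    using C(1) bounded_any_center[of C p] by (auto simp: dist_norm norm_minus_commute)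
  have "F u \<bullet> (p - u) - hr u \<le> B * R - (A - A' * R)" if u: "u \<in> C \<inter> dom_h" for u
  proof -
    have "F u \<bullet> (p - u) \<le> norm (F u) * norm (p - u)" by (rule norm_cauchy_schwarz)
    also have "\<dots> \<le> B * R"
      using FB[of u] R[of u] u order_trans[OF norm_ge_zero FB[of u]]
      by (intro mult_mono) (auto simp: norm_minus_commute)
    finally have "F u \<bullet> (p - u) \<le> B * R" .
    moreover have "A - A' * norm (u - p) \<le> hr u" using A(2)[of u] u by (simp add: h_eq)
    moreover have "A' * norm (u - p) \<le> A' * R" using R[of u] u A(1) by (intro mult_left_mono) auto
    ultimately show ?thesis by linarith
  qed
  then show ?thesis by (intro bdd_aboveI2)
qed

lemma Gap_eq:
  assumes p: "p \<in> dom_h"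
  shows "Gap F h C p = ereal (hr p + gap_sup F C p)"
  unfolding Gap_def
proof (rule SUP_eqI)
  fix u assume u: "u \<in> C"
  show "ereal (F u \<bullet> (p - u)) + h p - h u \<le> ereal (hr p + gap_sup F C p)"
  proof (cases "u \<in> dom_h")
    case True
    then have "F u \<bullet> (p - u) - hr u \<le> gap_sup F C p"
      unfolding gap_sup_def using u by (intro cSUP_upper gap_sup_bdd) auto
    then show ?thesis using True p by (simp add: h_eq)
  qed (use p in \<open>simp add: h_notin h_eq\<close>)
next
  fix y assume y: "\<And>u. u \<in> C \<Longrightarrow> ereal (F u \<bullet> (p - u)) + h p - h u \<le> y"
  show "ereal (hr p + gap_sup F C p) \<le> y"
  proof (cases y)
    case (real r)
    have "gap_sup F C p \<le> r - hr p"
      unfolding gap_sup_def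
    proof (rule cSUP_least[OF C(2)])
      fix u assume "u \<in> C \<inter> dom_h"
      then show "F u \<bullet> (p - u) - hr u \<le> r - hr p"
        using y[of u] real p by (simp add: h_eq)
    qed
    then show ?thesis using real by simp
  next
    case MInf
    obtain u where "u \<in> C \<inter> dom_h" using C(2) by blast
    then show ?thesis using y[of u] MInf p by (simp add: h_eq)
  qed simp
qed

lemma continuous_on_gap_sup: "continuous_on A (gap_sup F C)"
proof -
  have B: "0 \<le> B" using C(2) FB order_trans[OF norm_ge_zero] by blast
  have *: "gap_sup F C p \<le> gap_sup F C p' + B * norm (p - p')" for p p'
    unfolding gap_sup_def[of F C p]
  proof (rule cSUP_least[OF C(2)])
    fix u assume u: "u \<in> C \<inter> dom_h"
    have "F u \<bullet> (p' - u) - hr u \<le> gap_sup F C p'"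
      unfolding gap_sup_def using u by (intro cSUP_upper gap_sup_bdd) auto
    moreover have "F u \<bullet> (p - p') \<le> B * norm (p - p')"
      using norm_cauchy_schwarz[of "F u" "p - p'"] mult_right_mono[OF FB[of u], of "norm (p - p')"] u by simp
    ultimately show "F u \<bullet> (p - u) - hr u \<le> gap_sup F C p' + B * norm (p - p')"
      by (simp add: inner_diff_right)
  qed
  show ?thesis
  proof (rule lipschitz_on_continuous_on, rule lipschitz_onI)
    fix p p'
    show "dist (gap_sup F C p) (gap_sup F C p') \<le> B * dist p p'"
      using *[of p p'] *[of p' p] by (simp add: dist_norm norm_minus_commute abs_le_iff)
  qed fact
qed

end

lemma borel_measurable_hr: "hr \<in> borel_measurable borel"
  unfolding hr_def[abs_def] using borel_measurable_h by measurable

end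

section \<open>Quantization seeds and coins\<close>

text \<open>Preimages of measurable sets are closed under intersection, so independence extends to
  the generated \<sigma>-algebras. The hypothesis speaks of families of events because the coin
  enters through its bare preimages.\<close>

lemma (in prob_space) indep_varI:
  assumes "indep_set \<A> \<B>" and X: "X \<in> measurable M S" and Y: "Y \<in> measurable M T"
    and "\<And>A. A \<in> sets S \<Longrightarrow> X -` A \<inter> space M \<in> \<A>" "\<And>B. B \<in> sets T \<Longrightarrow> Y -` B \<inter> space M \<in> \<B>"
  shows "indep_var S X T Y"
proof -
  have "indep_set {X -` A \<inter> space M |A. A \<in> sets S} {Y -` A \<inter> space M |A. A \<in> sets T}"
    using indep_setD[OF assms(1)] assms(4,5) measurable_sets[OF X] measurable_sets[OF Y]
    by (intro indep_setI) auto
  moreover have "Int_stable {W -` A \<inter> space M |A. A \<in> sets U}" for W :: "'a \<Rightarrow> 'x" and U :: "'x measure"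
  proof (rule Int_stableI)
    fix a b assume "a \<in> {W -` A \<inter> space M |A. A \<in> sets U}" "b \<in> {W -` A \<inter> space M |A. A \<in> sets U}"
    then obtain A B where "A \<in> sets U" "B \<in> sets U" "a = W -` A \<inter> space M" "b = W -` B \<inter> space M" by blast
    then show "a \<inter> b \<in> {W -` A \<inter> space M |A. A \<in> sets U}"
      by (auto intro!: exI[of _ "A \<inter> B"])
  qed
  ultimately show ?thesis
    unfolding indep_var_eq by (intro conjI X Y indep_set_sigma_sets)
qed

text \<open>Checked on measurable rectangles. A product law is what lets Fubini integrate one
  variable with the other frozen.\<close>

lemma (in prob_space) distr_pair_indep:
  assumes ind: "indep_set \<A> \<B>" and X: "X \<in> measurable M S" and Y: "Y \<in> measurable M T"
    and A: "\<And>A. A \<in> sets S \<Longrightarrow> X -` A \<inter> space M \<in> \<A>"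
    and B: "\<And>B. B \<in> sets T \<Longrightarrow> Y -` B \<inter> space M \<in> \<B>"
  shows "distr M (S \<Otimes>\<^sub>M T) (\<lambda>x. (X x, Y x)) = distr M S X \<Otimes>\<^sub>M distr M T Y"
proof (rule pair_measure_eqI[symmetric])
  interpret DX: prob_space "distr M S X" by (rule prob_space_distr[OF X])
  interpret DY: prob_space "distr M T Y" by (rule prob_space_distr[OF Y])
  show "sigma_finite_measure (distr M S X)" "sigma_finite_measure (distr M T Y)"
    by unfold_locales
  show "sets (distr M S X \<Otimes>\<^sub>M distr M T Y) = sets (distr M (S \<Otimes>\<^sub>M T) (\<lambda>x. (X x, Y x)))"
    by simp
  have XY: "(\<lambda>x. (X x, Y x)) \<in> measurable M (S \<Otimes>\<^sub>M T)" using X Y by measurable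
  fix a b assume "a \<in> sets (distr M S X)" "b \<in> sets (distr M T Y)"
  then have ab: "a \<in> sets S" "b \<in> sets T" by auto
  have "(\<lambda>x. (X x, Y x)) -` (a \<times> b) \<inter> space M = (X -` a \<inter> space M) \<inter> (Y -` b \<inter> space M)"
    by auto
  then show "emeasure (distr M S X) a * emeasure (distr M T Y) b =
      emeasure (distr M (S \<Otimes>\<^sub>M T) (\<lambda>x. (X x, Y x))) (a \<times> b)"
    using indep_setD[OF ind A[OF ab(1)] B[OF ab(2)]] ab
    by (simp add: emeasure_distr[OF X] emeasure_distr[OF Y] emeasure_distr[OF XY] emeasure_eq_measure
        ennreal_mult)
qed

section \<open>Square-integrable random vectors\<close>

definition (in prob_space) square_integrable :: "('a \<Rightarrow> 'b::euclidean_space) \<Rightarrow> bool" where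
  "square_integrable f \<longleftrightarrow> f \<in> borel_measurable M \<and> integrable M (\<lambda>x. (norm (f x))\<^sup>2)"

context prob_space
begin

lemma square_integrable_measurable: "square_integrable f \<Longrightarrow> f \<in> borel_measurable M"
  by (simp add: square_integrable_def)

lemma square_integrable_norm: "square_integrable f \<Longrightarrow> integrable M (\<lambda>x. (norm (f x))\<^sup>2)"
  by (simp add: square_integrable_def)

lemma square_integrable_const: "square_integrable (\<lambda>_. c)"
  by (simp add: square_integrable_def)

lemma square_integrable_add:
  assumes "square_integrable f" "square_integrable g"
  shows "square_integrable (\<lambda>x. f x + g x)"
  unfolding square_integrable_def
proof
  note [measurable] = assms[THEN square_integrable_measurable]
  show "(\<lambda>x. f x + g x) \<in> borel_measurable M" by measurable
  show "integrable M (\<lambda>x. (norm (f x + g x))\<^sup>2)"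
    by (rule Bochner_Integration.integrable_bound[where f="\<lambda>x. 2 * (norm (f x))\<^sup>2 + 2 * (norm (g x))\<^sup>2"])
      (use assms[THEN square_integrable_norm] norm_sum_square_le in \<open>auto intro!: AE_I2\<close>)
qed

lemma square_integrable_scaleR:
  "square_integrable f \<Longrightarrow> square_integrable (\<lambda>x. c *\<^sub>R f x)"
  unfolding square_integrable_def by (auto simp: power_mult_distrib)

lemma square_integrable_diff:
  assumes "square_integrable f" "square_integrable g"
  shows "square_integrable (\<lambda>x. f x - g x)"
  using square_integrable_add[OF assms(1) square_integrable_scaleR[OF assms(2), of "-1"]] by simp

lemma square_integrable_bound:
  assumes "square_integrable f" "g \<in> borel_measurable M" "\<And>x. x \<in> space M \<Longrightarrow> norm (g x) \<le> norm (f x)"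
  shows "square_integrable g"
  unfolding square_integrable_def
proof
  show "integrable M (\<lambda>x. (norm (g x))\<^sup>2)"
    by (rule Bochner_Integration.integrable_bound[OF square_integrable_norm[OF assms(1)]])
      (use assms in \<open>auto intro!: AE_I2 power_mono\<close>)
qed fact

text \<open>Polarisation expresses the inner product through the squared norms of
  \<open>f + g\<close>, \<open>f\<close> and \<open>g\<close>.\<close>

lemma square_integrable_inner:
  assumes "square_integrable f" "square_integrable g"
  shows "integrable M (\<lambda>x. f x \<bullet> g x)"
proof -
  note [measurable] = assms[THEN square_integrable_measurable]
  have "(\<lambda>x. f x \<bullet> g x) = (\<lambda>x. ((norm (f x + g x))\<^sup>2 - (norm (f x))\<^sup>2 - (norm (g x))\<^sup>2) / 2)"
    unfolding power2_norm_eq_inner by (simp add: inner_add inner_commute)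
  moreover have "integrable M (\<lambda>x. ((norm (f x + g x))\<^sup>2 - (norm (f x))\<^sup>2 - (norm (g x))\<^sup>2) / 2)"
    using assms square_integrable_add[OF assms, THEN square_integrable_norm]
    by (intro integrable_divide Bochner_Integration.integrable_diff) (auto intro: square_integrable_norm)
  ultimately show ?thesis by simp
qed

end

section \<open>Information before a step, after its seed and after its coin\<close>

locale random_choices = prob_space M for M :: "'m measure" +
  fixes S :: "'s measure" and Q :: "'s \<Rightarrow> 'a::euclidean_space \<Rightarrow> 'a" and \<omega> \<tau> :: real and K :: nat
    and s :: "nat \<Rightarrow> 'm \<Rightarrow> 's" and b :: "nat \<Rightarrow> 'm \<Rightarrow> bool"
  assumes Q: "quantization S Q \<omega>" and \<tau>: "0 \<le> \<tau>" "\<tau> < 1"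
    and choices: "independent_choices M S \<tau> K s b"
begin

sublocale S: prob_space S
  using Q by (simp add: quantization_def)

abbreviation coin :: "bool measure" where
  "coin \<equiv> measure_pmf (bernoulli_pmf (1 - \<tau>))"

abbreviation X :: "nat \<Rightarrow> 'm \<Rightarrow> 's \<times> bool" where
  "X k x \<equiv> (s k x, b k x)"

text \<open>\<open>\<G> k\<close> is the information generated before step \<open>k\<close>; \<open>\<H> k\<close> also contains the seed
  of step \<open>k\<close>, but not its coin.\<close>
definition \<G> :: "nat \<Rightarrow> 'm measure" where
  "\<G> k = vimage_algebra (space M) (\<lambda>x. \<lambda>i\<in>{..<k}. X i x) (\<Pi>\<^sub>M i\<in>{..<k}. S \<Otimes>\<^sub>M coin)"

definition \<H> :: "nat \<Rightarrow> 'm measure" where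
  "\<H> k = vimage_algebra (space M) (\<lambda>x. (\<lambda>i\<in>{..<k}. X i x, s k x)) ((\<Pi>\<^sub>M i\<in>{..<k}. S \<Otimes>\<^sub>M coin) \<Otimes>\<^sub>M S)"

lemma space_\<G>[simp]: "space (\<G> k) = space M" and space_\<H>[simp]: "space (\<H> k) = space M"
  by (simp_all add: \<G>_def \<H>_def)

lemma indep_X: "indep_vars (\<lambda>_. S \<Otimes>\<^sub>M coin) X {..<K}"
  and distr_X: "k < K \<Longrightarrow> distr M (S \<Otimes>\<^sub>M coin) (X k) = S \<Otimes>\<^sub>M coin"
  using choices by (simp_all add: independent_choices_def Let_def)

lemma X_measurable: "k < K \<Longrightarrow> X k \<in> measurable M (S \<Otimes>\<^sub>M coin)"
  using indep_X by (simp add: indep_vars_def)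

lemma s_measurable: "k < K \<Longrightarrow> s k \<in> measurable M S"
  using measurable_compose[OF X_measurable measurable_fst] by simp

lemma b_measurable: "k < K \<Longrightarrow> b k \<in> measurable M coin"
  using measurable_compose[OF X_measurable measurable_snd] by simp

lemma past_in_space: "k \<le> K \<Longrightarrow> x \<in> space M \<Longrightarrow> (\<lambda>i\<in>{..<k}. X i x) \<in> space (\<Pi>\<^sub>M i\<in>{..<k}. S \<Otimes>\<^sub>M coin)"
  using measurable_space[OF X_measurable] by (auto simp: space_PiM)

lemma past_\<G>: "k \<le> K \<Longrightarrow> (\<lambda>x. \<lambda>i\<in>{..<k}. X i x) \<in> measurable (\<G> k) (\<Pi>\<^sub>M i\<in>{..<k}. S \<Otimes>\<^sub>M coin)"
  unfolding \<G>_def by (intro measurable_vimage_algebra1) (auto intro: past_in_space)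

lemma past_seed_\<H>: "k < K \<Longrightarrow>
  (\<lambda>x. (\<lambda>i\<in>{..<k}. X i x, s k x)) \<in> measurable (\<H> k) ((\<Pi>\<^sub>M i\<in>{..<k}. S \<Otimes>\<^sub>M coin) \<Otimes>\<^sub>M S)"
  unfolding \<H>_def
  by (intro measurable_vimage_algebra1)
    (use past_in_space measurable_space[OF s_measurable] in \<open>auto simp: space_pair_measure\<close>)

lemma s_\<H>: "k < K \<Longrightarrow> s k \<in> measurable (\<H> k) S"
  using measurable_compose[OF past_seed_\<H> measurable_snd] by simp

lemma X_\<G>: "i < k \<Longrightarrow> k \<le> K \<Longrightarrow> X i \<in> measurable (\<G> k) (S \<Otimes>\<^sub>M coin)"
  using measurable_compose[OF past_\<G> measurable_component_singleton[of i]] by simp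

lemma b_\<G>: "k < K \<Longrightarrow> b k \<in> measurable (\<G> (Suc k)) coin"
  using measurable_compose[OF X_\<G>[of k "Suc k"] measurable_snd] by simp

lemma s_\<G>: "k < K \<Longrightarrow> s k \<in> measurable (\<G> (Suc k)) S"
  using measurable_compose[OF X_\<G>[of k "Suc k"] measurable_fst] by simp

lemma sets_\<G>: "k \<le> K \<Longrightarrow> sets (\<G> k) \<subseteq> sets M"
  unfolding \<G>_def by (intro sets_image_in_sets measurable_restrict X_measurable) auto

lemma sets_\<H>: "k < K \<Longrightarrow> sets (\<H> k) \<subseteq> sets M"
  unfolding \<H>_def
  by (intro sets_image_in_sets measurable_Pair measurable_restrict X_measurable s_measurable) auto

lemma sets_\<G>_\<H>: "k < K \<Longrightarrow> sets (\<G> k) \<subseteq> sets (\<H> k)"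
  unfolding \<G>_def
  using measurable_compose[OF past_seed_\<H> measurable_fst] by (intro sets_image_in_sets) auto

lemma sets_\<H>_\<G>: "k < K \<Longrightarrow> sets (\<H> k) \<subseteq> sets (\<G> (Suc k))"
  unfolding \<H>_def
  by (intro sets_image_in_sets measurable_Pair measurable_restrict X_\<G> s_\<G>) auto

lemma measurable_sub:
  assumes "f \<in> measurable N T" "sets N \<subseteq> sets N'" "space N' = space N"
  shows "f \<in> measurable N' T"
  using assms unfolding measurable_def by auto

lemmas \<G>_M = measurable_sub[OF _ sets_\<G>]
lemmas \<G>_\<H> = measurable_sub[OF _ sets_\<G>_\<H>]
lemmas \<H>_\<G> = measurable_sub[OF _ sets_\<H>_\<G>]

text \<open>Disjoint blocks of an independent family generate independent \<sigma>-algebras. The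
  present block is a product over the single index \<open>k\<close>, so each event of
  \<open>X k\<close> is rewritten as the preimage of a one-factor box.\<close>

lemma indep_\<G>:
  assumes k: "k < K"
  shows "indep_set (sets (\<G> k)) {X k -` A \<inter> space M |A. A \<in> sets (S \<Otimes>\<^sub>M coin)}"
proof -
  have "indep_var (\<Pi>\<^sub>M i\<in>{..<k}. S \<Otimes>\<^sub>M coin) (\<lambda>x. \<lambda>i\<in>{..<k}. X i x)
      (\<Pi>\<^sub>M i\<in>{k}. S \<Otimes>\<^sub>M coin) (\<lambda>x. \<lambda>i\<in>{k}. X i x)"
    by (rule indep_var_restrict[OF indep_X]) (use k in auto)
  then have i: "indep_set (sets (\<G> k)) (sigma_sets (space M)
      {(\<lambda>x. \<lambda>i\<in>{k}. X i x) -` A \<inter> space M |A. A \<in> sets (\<Pi>\<^sub>M i\<in>{k}. S \<Otimes>\<^sub>M coin)})"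
    (is "indep_set _ (sigma_sets _ ?E)")
    by (simp add: indep_var_eq \<G>_def sets_vimage_algebra)
  have E: "X k -` A \<inter> space M \<in> ?E" if "A \<in> sets (S \<Otimes>\<^sub>M coin)" for A
    using that by (intro CollectI exI[of _ "\<Pi>\<^sub>E i\<in>{k}. A"] conjI sets_PiM_I_finite) auto
  show ?thesis
    using indep_setD[OF i] indep_setD_ev1[OF i] measurable_sets[OF X_measurable[OF k]] E
    by (intro indep_setI) (auto intro: sigma_sets.Basic)
qed

lemma prob_X:
  assumes "k < K" "C \<in> sets S"
  shows "prob (X k -` (C \<times> B) \<inter> space M) = measure S C * measure coin B"
proof -
  have "prob (X k -` (C \<times> B) \<inter> space M) = measure (distr M (S \<Otimes>\<^sub>M coin) (X k)) (C \<times> B)"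
    by (subst measure_distr) (use assms in \<open>auto intro: X_measurable\<close>)
  also have "\<dots> = measure S C * measure coin B"
    unfolding distr_X[OF assms(1)] using assms by (simp add: measure_def measure_pmf.emeasure_pair_measure_Times enn2real_mult)
  finally show ?thesis .
qed

lemma distr_s: "k < K \<Longrightarrow> distr M S (s k) = S"
proof -
  assume k: "k < K"
  have "distr M S (s k) = distr (distr M (S \<Otimes>\<^sub>M coin) (X k)) S fst"
    by (subst distr_distr) (use X_measurable[OF k] in \<open>auto simp: comp_def\<close>)
  also have "\<dots> = S"
    unfolding distr_X[OF k] by (rule prob_space.distr_pair_fst) (rule prob_space_measure_pmf)
  finally show ?thesis .
qed

lemma distr_b: "k < K \<Longrightarrow> distr M coin (b k) = coin"
proof (rule measure_eqI)
  assume k: "k < K"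
  fix B assume "B \<in> sets (distr M coin (b k))"
  have "b k -` B \<inter> space M = X k -` (space S \<times> B) \<inter> space M"
    using measurable_space[OF s_measurable[OF k]] by auto
  then show "emeasure (distr M coin (b k)) B = emeasure coin B"
    using prob_X[OF k sets.top, of B] b_measurable[OF k]
    by (simp add: emeasure_distr emeasure_eq_measure S.prob_space measure_pmf.emeasure_eq_measure)
qed simp

lemma distr_pair_seed:
  assumes k: "k < K" and u: "u \<in> measurable (\<G> k) T"
  shows "distr M (T \<Otimes>\<^sub>M S) (\<lambda>x. (u x, s k x)) = distr M T u \<Otimes>\<^sub>M S"
proof (subst (2) distr_s[OF k, symmetric], rule distr_pair_indep[OF indep_\<G>[OF k]])
  show "u \<in> measurable M T" using k by (intro \<G>_M[OF u]) auto
  show "s k \<in> measurable M S" by (rule s_measurable[OF k])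
  show "u -` A \<inter> space M \<in> sets (\<G> k)" if "A \<in> sets T" for A
    using measurable_sets[OF u that] by simp
  show "s k -` B \<inter> space M \<in> {X k -` A \<inter> space M |A. A \<in> sets (S \<Otimes>\<^sub>M coin)}" if "B \<in> sets S" for B
    using that by (auto intro!: exI[of _ "B \<times> UNIV"])
qed

text \<open>Intersections of a past event with an event of the seed form an intersection-stable
  generator of \<open>\<H> k\<close>. On them independence of the coin combines two facts: the pair
  \<open>X k\<close> is independent of the past, and its law is a product.\<close>

lemma indep_\<H>:
  assumes k: "k < K"
  shows "indep_set (sets (\<H> k)) {b k -` B \<inter> space M |B. B \<in> sets coin}"
proof -
  define R where "R = {A \<inter> (s k -` C \<inter> space M) |A C. A \<in> sets (\<G> k) \<and> C \<in> sets S}"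
  define E where "E = {b k -` B \<inter> space M |B. B \<in> sets coin}"
  have RM: "R \<subseteq> sets M"
    using sets_\<G>[of k] k measurable_sets[OF s_measurable[OF k]] by (auto simp: R_def)
  have EM: "E \<subseteq> sets M" using measurable_sets[OF b_measurable[OF k]] by (auto simp: E_def)
  note D = indep_setD[OF indep_\<G>[OF k]]
  have "indep_set R E"
  proof (rule indep_setI[OF RM EM])
    fix r e assume "r \<in> R" "e \<in> E"
    then obtain A C B where A: "A \<in> sets (\<G> k)" and C: "C \<in> sets S"
      and r: "r = A \<inter> (s k -` C \<inter> space M)" and e: "e = b k -` B \<inter> space M"
      by (auto simp: R_def E_def)
    \<comment> \<open>The free \<open>B'\<close> serves twice: \<open>B\<close> for the intersection
      with \<open>e\<close>, and \<open>UNIV\<close> for \<open>r\<close> alone.\<close>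
    have 1: "prob (A \<inter> (X k -` (C \<times> B') \<inter> space M)) = prob A * (measure S C * measure coin B')" for B'
      unfolding prob_X[OF k C, symmetric] using C
      by (intro D[OF A] CollectI exI[of _ "C \<times> B'"] conjI refl) simp
    have re: "r \<inter> e = A \<inter> (X k -` (C \<times> B) \<inter> space M)" and rU: "r = A \<inter> (X k -` (C \<times> UNIV) \<inter> space M)"
      by (auto simp: r e)
    have eU: "e = X k -` (space S \<times> B) \<inter> space M"
      using measurable_space[OF s_measurable[OF k]] by (auto simp: e)
    have "prob r = prob A * measure S C" using 1[of UNIV] by (simp add: rU)
    moreover have "prob e = measure coin B" using prob_X[OF k sets.top, of B] by (simp add: eU S.prob_space)
    ultimately show "prob (r \<inter> e) = prob r * prob e" unfolding re 1 by simp
  qed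
  moreover have "Int_stable R"
  proof (rule Int_stableI)
    fix r r' assume "r \<in> R" "r' \<in> R"
    then obtain A C A' C' where "A \<in> sets (\<G> k)" "C \<in> sets S" "A' \<in> sets (\<G> k)" "C' \<in> sets S"
      "r = A \<inter> (s k -` C \<inter> space M)" "r' = A' \<inter> (s k -` C' \<inter> space M)" by (auto simp: R_def)
    then show "r \<inter> r' \<in> R" unfolding R_def
      by (intro CollectI exI[of _ "A \<inter> A'"] exI[of _ "C \<inter> C'"]) auto
  qed
  moreover have "Int_stable E"
  proof (rule Int_stableI)
    fix r r' assume "r \<in> E" "r' \<in> E"
    then obtain B B' where "r = b k -` B \<inter> space M" "r' = b k -` B' \<inter> space M" by (auto simp: E_def)
    then show "r \<inter> r' \<in> E" unfolding E_def by (intro CollectI exI[of _ "B \<inter> B'"]) auto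
  qed
  ultimately have i: "indep_set (sigma_sets (space M) R) (sigma_sets (space M) E)"
    by (rule indep_set_sigma_sets)
  \<comment> \<open>Past and seed are both measurable for the \<sigma>-algebra generated by
    \<open>R\<close>, hence it contains \<open>\<H> k\<close>.\<close>
  define N where "N = sigma (space M) R"
  have N: "space N = space M" "sets N = sigma_sets (space M) R"
    using RM sets.space_closed[of M] by (simp_all add: N_def space_measure_of_conv sets_measure_of)
  have "A \<in> R" if "A \<in> sets (\<G> k)" for A
    unfolding R_def using that sets.sets_into_space[OF that] measurable_space[OF s_measurable[OF k]]
    by (intro CollectI exI[of _ A] exI[of _ "space S"]) auto
  then have "sets (\<G> k) \<subseteq> sets N" unfolding N by (auto intro: sigma_sets.Basic)
  then have p: "(\<lambda>x. \<lambda>i\<in>{..<k}. X i x) \<in> measurable N (\<Pi>\<^sub>M i\<in>{..<k}. S \<Otimes>\<^sub>M coin)"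
    using k by (intro measurable_sub[OF past_\<G>]) (auto simp: N)
  have "s k -` C \<inter> space M \<in> R" if "C \<in> sets S" for C
    unfolding R_def using that sets.top[of "\<G> k"]
    by (intro CollectI exI[of _ "space M"] exI[of _ C]) auto
  then have sN: "s k \<in> measurable N S"
    using measurable_space[OF s_measurable[OF k]] by (intro measurableI) (auto simp: N intro: sigma_sets.Basic)
  have "sets (\<H> k) \<subseteq> sets N"
    unfolding \<H>_def by (intro sets_image_in_sets measurable_Pair p sN) (simp add: N)
  then show ?thesis
    unfolding E_def[symmetric] using indep_setD[OF i] sets_\<H>[OF k] EM
    by (intro indep_setI) (auto simp: N intro: sigma_sets.Basic)
qed

text \<open>The coin is independent of \<open>\<H> k\<close>, so after splitting by indicators each
  summand factors into an expectation and the probability of one side of the coin.\<close>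

lemma coin_integral:
  assumes k: "k < K" and f: "f \<in> borel_measurable (\<H> k)" "integrable M f"
    and g: "g \<in> borel_measurable (\<H> k)" "integrable M g"
  shows "integrable M (\<lambda>x. if b k x then f x else g x)"
    and "(\<integral>x. (if b k x then f x else g x) \<partial>M) = (1 - \<tau>) * (\<integral>x. f x \<partial>M) + \<tau> * (\<integral>x. g x \<partial>M :: real)"
proof -
  note bm = b_measurable[OF k]
  \<comment> \<open>An arbitrary weight \<open>c\<close> covers both sides at once:
    \<open>of_bool\<close> for success and its negated version for failure.\<close>
  have *: "integrable M (\<lambda>x. f x * c (b k x)) \<and>
      (\<integral>x. f x * c (b k x) \<partial>M) = (\<integral>x. f x \<partial>M) * (c True * (1 - \<tau>) + c False * \<tau>)"
    if f: "f \<in> borel_measurable (\<H> k)" "integrable M f" for f :: "'m \<Rightarrow> real" and c :: "bool \<Rightarrow> real"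
  proof -
    have cb: "(\<lambda>x. c (b k x)) \<in> borel_measurable M"
      by (rule measurable_compose[OF bm]) simp
    have iv: "indep_var borel f borel (\<lambda>x. c (b k x))"
    proof (rule indep_varI[OF indep_\<H>[OF k]])
      show "f -` A \<inter> space M \<in> sets (\<H> k)" if "A \<in> sets borel" for A
        using measurable_sets[OF f(1) that] by simp
      show "(\<lambda>x. c (b k x)) -` B \<inter> space M \<in> {b k -` B \<inter> space M |B. B \<in> sets coin}" for B
        by (auto intro!: exI[of _ "c -` B"])
    qed (use f cb in auto)
    have ic: "integrable M (\<lambda>x. c (b k x))"
      by (intro integrable_const_bound[where B="max \<bar>c True\<bar> \<bar>c False\<bar>"] AE_I2 cb)
        (metis max.cobounded1 max.cobounded2 real_norm_def)
    have "(\<integral>x. c (b k x) \<partial>M) = (\<integral>x. c x \<partial>distr M coin (b k))"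
      by (rule integral_distr[symmetric]) (use bm in auto)
    also have "\<dots> = c True * (1 - \<tau>) + c False * \<tau>"
      unfolding distr_b[OF k] using \<tau> by (subst integral_bernoulli_pmf) auto
    finally show ?thesis
      using indep_var_lebesgue_integral[OF iv f(2) ic] indep_var_integrable[OF iv f(2) ic] by simp
  qed
  have e: "(if b k x then f x else g x) = f x * of_bool (b k x) + g x * of_bool (\<not> b k x)" for x
    by simp
  show "integrable M (\<lambda>x. if b k x then f x else g x)"
    unfolding e using *[OF f, of of_bool] *[OF g, of "\<lambda>b. of_bool (\<not> b)"] by auto
  show "(\<integral>x. (if b k x then f x else g x) \<partial>M) = (1 - \<tau>) * (\<integral>x. f x \<partial>M) + \<tau> * (\<integral>x. g x \<partial>M)"
    unfolding e using *[OF f, of of_bool] *[OF g, of "\<lambda>b. of_bool (\<not> b)"]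
    by (subst Bochner_Integration.integral_add) auto
qed

section \<open>Averaging over the seed of the quantization\<close>

lemma Q_measurable: "(\<lambda>(s, x). Q s x) \<in> borel_measurable (S \<Otimes>\<^sub>M borel)"
  and Q_integrable: "integrable S (\<lambda>s. Q s y)"
  and Q_mean: "(\<integral>s. Q s y \<partial>S) = y"
  and Q_square_integrable: "integrable S (\<lambda>s. (norm (Q s y))\<^sup>2)"
  and Q_second_moment: "(\<integral>s. (norm (Q s y))\<^sup>2 \<partial>S) = \<omega> * (norm y)\<^sup>2"
  using Q by (simp_all add: quantization_def)

lemma Q_measurable_compose:
  assumes "f \<in> measurable N S" "u \<in> borel_measurable N"
  shows "(\<lambda>x. Q (f x) (u x)) \<in> borel_measurable N"
  using measurable_compose[OF measurable_Pair[OF assms] Q_measurable] by simp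

text \<open>At a basis vector, which has norm 1, the second moment is \<omega> itself.\<close>

lemma \<omega>_nonneg: "0 \<le> \<omega>"
proof -
  obtain y :: 'a where "y \<in> Basis" using nonempty_Basis by blast
  then have "\<omega> = (\<integral>s. (norm (Q s y))\<^sup>2 \<partial>S)" by (simp add: Q_second_moment)
  then show ?thesis by simp
qed

text \<open>Under the product law of \<open>u\<close> and the seed, the seed is integrated first;
  for a frozen argument the second moment is the one postulated of \<open>Q\<close>. Joint
  measurability of \<open>Q\<close> enters here.\<close>

lemma quantization_step:
  assumes k: "k < K" and u: "u \<in> borel_measurable (\<G> k)" "square_integrable u"
  shows "square_integrable (\<lambda>x. Q (s k x) (u x))"
    and "(\<integral>x. (norm (Q (s k x) (u x)))\<^sup>2 \<partial>M) = \<omega> * (\<integral>x. (norm (u x))\<^sup>2 \<partial>M)"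
proof -
  have uM[measurable]: "u \<in> borel_measurable M" by (rule square_integrable_measurable[OF u(2)])
  interpret U: prob_space "distr M borel u" by (rule prob_space_distr) (rule uM)
  interpret US: pair_sigma_finite "distr M borel u" S ..
  let ?f = "\<lambda>p. (norm (Q (snd p) (fst p)))\<^sup>2"
  have [measurable]: "(\<lambda>p. Q (snd p) (fst p)) \<in> borel_measurable (borel \<Otimes>\<^sub>M S)"
    by (rule Q_measurable_compose) measurable
  have su: "(\<lambda>x. (u x, s k x)) \<in> measurable M (borel \<Otimes>\<^sub>M S)"
    using s_measurable[OF k] by measurable
  have iu: "integrable (distr M borel u) (\<lambda>y. \<omega> * (norm y)\<^sup>2)"
    using square_integrable_norm[OF u(2)] by (subst integrable_distr_eq) auto
  have int: "integrable (distr M borel u \<Otimes>\<^sub>M S) ?f"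
  proof (rule US.Fubini_integrable)
    show "?f \<in> borel_measurable (distr M borel u \<Otimes>\<^sub>M S)" by measurable
  qed (use iu in \<open>simp_all add: Q_square_integrable Q_second_moment\<close>)
  have "integrable M (\<lambda>x. ?f (u x, s k x))"
    using int unfolding distr_pair_seed[OF k u(1), symmetric]
    by (subst (asm) integrable_distr_eq[OF su]) auto
  moreover have "(\<lambda>x. Q (s k x) (u x)) \<in> borel_measurable M"
    by (rule Q_measurable_compose[OF s_measurable[OF k] uM])
  ultimately show "square_integrable (\<lambda>x. Q (s k x) (u x))"
    by (simp add: square_integrable_def)
  have "(\<integral>x. ?f (u x, s k x) \<partial>M) = (\<integral>p. ?f p \<partial>(distr M borel u \<Otimes>\<^sub>M S))"
    unfolding distr_pair_seed[OF k u(1), symmetric] by (rule integral_distr[OF su, symmetric]) auto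
  also have "\<dots> = (\<integral>y. \<omega> * (norm y)\<^sup>2 \<partial>distr M borel u)"
    unfolding US.integral_fst'[OF int, symmetric] by (simp add: Q_second_moment)
  also have "\<dots> = \<omega> * (\<integral>x. (norm (u x))\<^sup>2 \<partial>M)"
    by (subst integral_distr) auto
  finally show "(\<integral>x. (norm (Q (s k x) (u x)))\<^sup>2 \<partial>M) = \<omega> * (\<integral>x. (norm (u x))\<^sup>2 \<partial>M)" by simp
qed

lemma quantization_unbiased:
  assumes k: "k < K" and u: "u \<in> borel_measurable (\<G> k)" "square_integrable u"
    and v: "v \<in> borel_measurable (\<G> k)" "square_integrable v"
  shows "(\<integral>x. (Q (s k x) (u x) - u x) \<bullet> v x \<partial>M) = 0"
proof -
  \<comment> \<open>Both \<open>u\<close> and \<open>v\<close> have to be frozen while the seed is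
    averaged, so the past variable in the product law is the pair.\<close>
  have uvG: "(\<lambda>x. (u x, v x)) \<in> borel_measurable (\<G> k)" using u v by measurable
  have uvM[measurable]: "(\<lambda>x. (u x, v x)) \<in> borel_measurable M" using k by (intro \<G>_M[OF uvG]) auto
  let ?D = "distr M borel (\<lambda>x. (u x, v x))"
  interpret U: prob_space ?D by (rule prob_space_distr) (rule uvM)
  interpret US: pair_sigma_finite ?D S ..
  let ?f = "\<lambda>p. (Q (snd p) (fst (fst p)) - fst (fst p)) \<bullet> snd (fst p)"
  have "(\<lambda>p. Q (snd p) (fst (fst p))) \<in> borel_measurable (borel \<Otimes>\<^sub>M S)"
    by (rule Q_measurable_compose) (auto intro!: measurable_compose[OF measurable_fst] borel_measurable_continuous_onI continuous_intros)
  moreover have "(\<lambda>p. fst (fst p)) \<in> borel_measurable (borel \<Otimes>\<^sub>M S)" "(\<lambda>p. snd (fst p)) \<in> borel_measurable (borel \<Otimes>\<^sub>M S)"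

    by (auto intro!: measurable_compose[OF measurable_fst] borel_measurable_continuous_onI continuous_intros)
  ultimately have [measurable]: "?f \<in> borel_measurable (borel \<Otimes>\<^sub>M S)"
    by measurable
  have su: "(\<lambda>x. ((u x, v x), s k x)) \<in> measurable M (borel \<Otimes>\<^sub>M S)"
    using s_measurable[OF k] by measurable
  have "integrable M (\<lambda>x. ?f ((u x, v x), s k x))"
    using square_integrable_inner[OF square_integrable_diff[OF quantization_step(1)[OF k u] u(2)] v(2)] by simp
  then have int: "integrable (?D \<Otimes>\<^sub>M S) ?f"
    unfolding distr_pair_seed[OF k uvG, symmetric] by (subst integrable_distr_eq[OF su]) auto
  have "(\<integral>x. ?f ((u x, v x), s k x) \<partial>M) = (\<integral>p. ?f p \<partial>(?D \<Otimes>\<^sub>M S))"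
    unfolding distr_pair_seed[OF k uvG, symmetric] by (rule integral_distr[OF su, symmetric]) auto
  also have "\<dots> = (\<integral>y. (\<integral>s. ?f (y, s) \<partial>S) \<partial>?D)"
    by (rule US.integral_fst'[OF int, symmetric])
  also have "(\<lambda>y. \<integral>s. ?f (y, s) \<partial>S) = (\<lambda>_. 0)"
    by (simp add: Q_integrable Q_mean S.prob_space)
  finally show ?thesis by simp
qed

end

section \<open>The iterates\<close>

locale quant_ES_run = proper_lsc_convex h + random_choices M S Q \<omega> \<tau> K s b
  for h :: "'a::euclidean_space \<Rightarrow> ereal" and M :: "'m measure" and S :: "'s measure"
    and Q :: "'s \<Rightarrow> 'a \<Rightarrow> 'a" and \<omega> \<tau> :: real and K :: nat
    and s :: "nat \<Rightarrow> 'm \<Rightarrow> 's" and b :: "nat \<Rightarrow> 'm \<Rightarrow> bool" +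
  fixes F :: "'a \<Rightarrow> 'a" and Z :: "'a set" and L D \<gamma> :: real and z0 :: 'a
    and z zhalf w :: "nat \<Rightarrow> 'm \<Rightarrow> 'a"
  assumes dom_Z: "dom_h \<subseteq> Z" and \<gamma>: "0 < \<gamma>"
    and F_measurable: "F \<in> borel_measurable (restrict_space borel Z)"
    and F_lipschitz: "boundedly_lipschitz F Z L D" and z0: "z0 \<in> Z"
    and iterates: "\<And>x. x \<in> space M \<Longrightarrow>
      quant_ES h F Q \<gamma> \<tau> K z0 (\<lambda>k. s k x) (\<lambda>k. b k x)
        (\<lambda>k. z k x) (\<lambda>k. zhalf k x) (\<lambda>k. w k x)"
begin

definition v :: "nat \<Rightarrow> 'm \<Rightarrow> 'a" where
  "v k x = F (zhalf k x) - F (w k x)"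

definition q :: "nat \<Rightarrow> 'm \<Rightarrow> 'a" where
  "q k x = Q (s k x) (v k x)"

lemma start: "x \<in> space M \<Longrightarrow> z 0 x = z0" "x \<in> space M \<Longrightarrow> w 0 x = z0"
  using iterates by (auto simp: quant_ES_def)

lemma zhalf_eq: "k < K \<Longrightarrow> x \<in> space M \<Longrightarrow>
    zhalf k x = prox \<gamma> h (\<tau> *\<^sub>R z k x + (1 - \<tau>) *\<^sub>R w k x - \<gamma> *\<^sub>R F (w k x))"
  and z_Suc: "k < K \<Longrightarrow> x \<in> space M \<Longrightarrow>
    z (Suc k) x = prox \<gamma> h (\<tau> *\<^sub>R z k x + (1 - \<tau>) *\<^sub>R w k x - \<gamma> *\<^sub>R q k x - \<gamma> *\<^sub>R F (w k x))"
  and w_Suc: "k < K \<Longrightarrow> x \<in> space M \<Longrightarrow> w (Suc k) x = (if b k x then z (Suc k) x else w k x)"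
  using iterates[of x] by (auto simp: quant_ES_def Let_def q_def v_def)

lemma zhalf_dom: "k < K \<Longrightarrow> x \<in> space M \<Longrightarrow> zhalf k x \<in> dom_h"
  by (simp add: zhalf_eq prox_in_dom[OF \<gamma>])

lemma z_Suc_dom: "k < K \<Longrightarrow> x \<in> space M \<Longrightarrow> z (Suc k) x \<in> dom_h"
  by (simp add: z_Suc prox_in_dom[OF \<gamma>])

text \<open>\<open>Z\<close> rather than \<open>dom_h\<close>, because \<open>w\<close> keeps the
  starting point \<open>z0\<close> until a coin succeeds, and \<open>z0\<close> is only known to lie
  in \<open>Z\<close>.\<close>

lemma w_Z: "k \<le> K \<Longrightarrow> x \<in> space M \<Longrightarrow> w k x \<in> Z"
proof (induction k)
  case (Suc k)
  then show ?case using z_Suc_dom[of k x] dom_Z by (auto simp: w_Suc)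
qed (simp add: start z0)

text \<open>\<open>F\<close> is measurable as a map on \<open>Z\<close> only, so every composition
  carries a range condition.\<close>

lemma F_compose:
  assumes "f \<in> borel_measurable N" "\<And>x. x \<in> space N \<Longrightarrow> f x \<in> Z"
  shows "(\<lambda>x. F (f x)) \<in> borel_measurable N"
  by (rule measurable_compose[OF measurable_restrict_space2 F_measurable]) (use assms in auto)

text \<open>The moment at which a quantity becomes known decides which average may treat it as
  frozen: \<open>zhalf k\<close> and \<open>v k\<close> precede the seed, \<open>q k\<close> and
  \<open>z (Suc k)\<close> need the seed but not the coin, \<open>w (Suc k)\<close> needs
  both.\<close>

lemma step_measurable:
  assumes k: "k < K" and z: "z k \<in> borel_measurable (\<G> k)" and w: "w k \<in> borel_measurable (\<G> k)"
  shows "zhalf k \<in> borel_measurable (\<G> k)" and "v k \<in> borel_measurable (\<G> k)"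
    and "q k \<in> borel_measurable (\<H> k)" and "z (Suc k) \<in> borel_measurable (\<H> k)"
    and "w (Suc k) \<in> borel_measurable (\<G> (Suc k))"
proof -
  note [measurable] = z w borel_measurable_prox[OF \<gamma>]
  have Fw[measurable]: "(\<lambda>x. F (w k x)) \<in> borel_measurable (\<G> k)"
    by (rule F_compose) (use k w_Z in auto)
  have "(\<lambda>x. prox \<gamma> h (\<tau> *\<^sub>R z k x + (1 - \<tau>) *\<^sub>R w k x - \<gamma> *\<^sub>R F (w k x))) \<in> borel_measurable (\<G> k)"
    by measurable
  then show zh[measurable]: "zhalf k \<in> borel_measurable (\<G> k)"
    using k by (subst measurable_cong[OF zhalf_eq]) auto
  have Fzh[measurable]: "(\<lambda>x. F (zhalf k x)) \<in> borel_measurable (\<G> k)"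
    by (rule F_compose) (use k zhalf_dom dom_Z in auto)
  show v[measurable]: "v k \<in> borel_measurable (\<G> k)"
    unfolding v_def[abs_def] by measurable
  show q[measurable]: "q k \<in> borel_measurable (\<H> k)"
    unfolding q_def[abs_def] using k by (intro Q_measurable_compose s_\<H> \<G>_\<H>[OF v]) auto
  have [measurable]: "z k \<in> borel_measurable (\<H> k)" "w k \<in> borel_measurable (\<H> k)"
    "(\<lambda>x. F (w k x)) \<in> borel_measurable (\<H> k)"
    using k by (auto intro: \<G>_\<H>[OF z] \<G>_\<H>[OF w] \<G>_\<H>[OF Fw])
  have "(\<lambda>x. prox \<gamma> h (\<tau> *\<^sub>R z k x + (1 - \<tau>) *\<^sub>R w k x - \<gamma> *\<^sub>R q k x - \<gamma> *\<^sub>R F (w k x)))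
      \<in> borel_measurable (\<H> k)"
    by measurable
  then show zp: "z (Suc k) \<in> borel_measurable (\<H> k)"
    using k by (subst measurable_cong[OF z_Suc]) auto
  have [measurable]: "z (Suc k) \<in> borel_measurable (\<G> (Suc k))" "w k \<in> borel_measurable (\<G> (Suc k))"
    using k by (auto intro: \<H>_\<G>[OF zp] \<H>_\<G>[OF \<open>w k \<in> borel_measurable (\<H> k)\<close>])
  have "Measurable.pred (\<G> (Suc k)) (b k)"
    using b_\<G>[OF k] by (simp add: measurable_def)
  then have "(\<lambda>x. if b k x then z (Suc k) x else w k x) \<in> borel_measurable (\<G> (Suc k))"
    by measurable
  then show "w (Suc k) \<in> borel_measurable (\<G> (Suc k))"
    using k by (subst measurable_cong[OF w_Suc]) auto
qed

lemma zw_measurable: "k \<le> K \<Longrightarrow> z k \<in> borel_measurable (\<G> k) \<and> w k \<in> borel_measurable (\<G> k)"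
proof (induction k)
  case 0
  have "z 0 \<in> borel_measurable (\<G> 0)" by (subst measurable_cong[of _ _ "\<lambda>_. z0"]) (auto simp: start)
  moreover have "w 0 \<in> borel_measurable (\<G> 0)" by (subst measurable_cong[of _ _ "\<lambda>_. z0"]) (auto simp: start)
  ultimately show ?case by simp
next
  case (Suc k)
  then have k: "k < K" and zw: "z k \<in> borel_measurable (\<G> k)" "w k \<in> borel_measurable (\<G> k)" by simp_all
  show ?case
    using \<H>_\<G>[OF step_measurable(4)[OF k zw] k] step_measurable(5)[OF k zw] by simp
qed

lemmas z_\<G> = zw_measurable[THEN conjunct1] and w_\<G> = zw_measurable[THEN conjunct2]

lemma zhalf_\<G>: "k < K \<Longrightarrow> zhalf k \<in> borel_measurable (\<G> k)"
  and v_\<G>: "k < K \<Longrightarrow> v k \<in> borel_measurable (\<G> k)"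
  and q_\<H>: "k < K \<Longrightarrow> q k \<in> borel_measurable (\<H> k)"
  and z_\<H>: "k < K \<Longrightarrow> z (Suc k) \<in> borel_measurable (\<H> k)"
  and w_\<H>: "k < K \<Longrightarrow> w k \<in> borel_measurable (\<H> k)"
proof -
  assume k: "k < K"
  then have zw: "z k \<in> borel_measurable (\<G> k)" "w k \<in> borel_measurable (\<G> k)"
    by (simp_all add: z_\<G> w_\<G>)
  show "zhalf k \<in> borel_measurable (\<G> k)" "v k \<in> borel_measurable (\<G> k)"
    "q k \<in> borel_measurable (\<H> k)" "z (Suc k) \<in> borel_measurable (\<H> k)"
    by (rule step_measurable[OF k zw])+
  show "w k \<in> borel_measurable (\<H> k)"
    by (rule \<G>_\<H>[OF zw(2) k]) simp
qed

section \<open>Square integrability of the iterates and second moments of one step\<close>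

lemma square_integrable_norm_real: "square_integrable f \<Longrightarrow> square_integrable (\<lambda>x. norm (f x))"
  by (rule square_integrable_bound[of f]) (auto dest: square_integrable_measurable)

text \<open>Bounded Lipschitz continuity implies linear growth around \<open>z0\<close>: the root of
  \<open>L\<^sup>2 * r\<^sup>2 + D\<^sup>2\<close> is at most \<open>L * r + D\<close>.\<close>

lemma square_integrable_F:
  assumes f: "square_integrable f" and Z: "\<And>x. x \<in> space M \<Longrightarrow> f x \<in> Z"
  shows "square_integrable (\<lambda>x. F (f x))"
proof (rule square_integrable_bound)
  show "square_integrable (\<lambda>x. L *\<^sub>R norm (f x - z0) + (D + norm (F z0)))"
    by (intro square_integrable_add square_integrable_scaleR square_integrable_norm_real
        square_integrable_diff f square_integrable_const)
  show "(\<lambda>x. F (f x)) \<in> borel_measurable M"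
    using F_compose[OF square_integrable_measurable[OF f] Z] .
  fix x assume x: "x \<in> space M"
  have LD: "0 \<le> L" "0 \<le> D" using F_lipschitz by (auto simp: boundedly_lipschitz_def)
  have "(norm (F (f x) - F z0))\<^sup>2 \<le> L\<^sup>2 * (norm (f x - z0))\<^sup>2 + D\<^sup>2"
    using F_lipschitz Z[OF x] z0 by (auto simp: boundedly_lipschitz_def)
  also have "\<dots> \<le> (L * norm (f x - z0) + D)\<^sup>2"
    using LD by (simp add: power2_sum power_mult_distrib)
  finally have "norm (F (f x) - F z0) \<le> L * norm (f x - z0) + D"
    using LD by (simp add: power2_le_iff_abs_le)
  then show "norm (F (f x)) \<le> norm (L *\<^sub>R norm (f x - z0) + (D + norm (F z0)))"
    using norm_triangle_sub[of "F (f x)" "F z0"] by simp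
qed

lemma square_integrable_prox:
  assumes f: "square_integrable f"
  shows "square_integrable (\<lambda>x. prox \<gamma> h (f x))"
proof (rule square_integrable_bound)
  show "square_integrable (\<lambda>x. norm (f x) + norm (prox \<gamma> h 0))"
    by (intro square_integrable_add square_integrable_norm_real square_integrable_const f)
  show "(\<lambda>x. prox \<gamma> h (f x)) \<in> borel_measurable M"
    using measurable_compose[OF square_integrable_measurable[OF f] borel_measurable_prox[OF \<gamma>]] .
  show "norm (prox \<gamma> h (f x)) \<le> norm (norm (f x) + norm (prox \<gamma> h 0))" for x
    using norm_triangle_sub[of "prox \<gamma> h (f x)" "prox \<gamma> h 0"] prox_nonexpansive[OF \<gamma>, of "f x" 0] by simp
qed

lemma square_integrable_cong:
  assumes "\<And>x. x \<in> space M \<Longrightarrow> f x = g x"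
  shows "square_integrable f \<longleftrightarrow> square_integrable g"
proof -
  have "f \<in> borel_measurable M \<longleftrightarrow> g \<in> borel_measurable M"
    by (rule measurable_cong[OF assms])
  moreover have "integrable M (\<lambda>x. (norm (f x))\<^sup>2) \<longleftrightarrow> integrable M (\<lambda>x. (norm (g x))\<^sup>2)"
    by (rule Bochner_Integration.integrable_cong) (simp_all add: assms)
  ultimately show ?thesis by (simp add: square_integrable_def)
qed

lemma step_square_integrable:
  assumes k: "k < K" and z: "square_integrable (z k)" and w: "square_integrable (w k)"
  shows "square_integrable (zhalf k)" and "square_integrable (v k)" and "square_integrable (q k)"
    and "square_integrable (z (Suc k))" and "square_integrable (w (Suc k))"
proof -
  have Fw: "square_integrable (\<lambda>x. F (w k x))"
    using k w_Z by (intro square_integrable_F w) auto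
  show zh: "square_integrable (zhalf k)"
    by (subst square_integrable_cong[OF zhalf_eq[OF k]])
      (auto intro!: square_integrable_prox square_integrable_add square_integrable_diff
        square_integrable_scaleR z w Fw)
  show v: "square_integrable (v k)"
    unfolding v_def[abs_def] using k zhalf_dom dom_Z
    by (intro square_integrable_diff Fw square_integrable_F zh) auto
  show q: "square_integrable (q k)"
    unfolding q_def[abs_def] using k by (intro quantization_step v v_\<G>)
  show zp: "square_integrable (z (Suc k))"
    by (subst square_integrable_cong[OF z_Suc[OF k]])
      (auto intro!: square_integrable_prox square_integrable_add square_integrable_diff
        square_integrable_scaleR z w Fw q)
  show "square_integrable (w (Suc k))"
  proof (rule square_integrable_bound)
    show "square_integrable (\<lambda>x. norm (z (Suc k) x) + norm (w k x))"
      by (intro square_integrable_add square_integrable_norm_real zp w)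
    show "w (Suc k) \<in> borel_measurable M" using k by (intro \<G>_M[OF w_\<G>]) auto
    show "norm (w (Suc k) x) \<le> norm (norm (z (Suc k) x) + norm (w k x))" if "x \<in> space M" for x
      using w_Suc[OF k that] by simp
  qed
qed

lemma zw_square_integrable: "k \<le> K \<Longrightarrow> square_integrable (z k) \<and> square_integrable (w k)"
proof (induction k)
  case 0
  have "square_integrable (z 0)" by (subst square_integrable_cong[of _ "\<lambda>_. z0"]) (auto simp: start square_integrable_const)
  moreover have "square_integrable (w 0)" by (subst square_integrable_cong[of _ "\<lambda>_. z0"]) (auto simp: start square_integrable_const)
  ultimately show ?case by simp
next
  case (Suc k)
  then show ?case using step_square_integrable[of k] by auto
qed

lemmas z_sq = zw_square_integrable[THEN conjunct1] and w_sq = zw_square_integrable[THEN conjunct2]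

lemma zhalf_sq: "k < K \<Longrightarrow> square_integrable (zhalf k)"
  and v_sq: "k < K \<Longrightarrow> square_integrable (v k)"
  and q_sq: "k < K \<Longrightarrow> square_integrable (q k)"
  by (rule step_square_integrable; simp add: z_sq w_sq)+

lemma norm_diff_integrable:
  assumes "square_integrable f" "square_integrable g"
  shows "integrable M (\<lambda>x. (norm (f x - g x))\<^sup>2)"
  by (intro square_integrable_norm square_integrable_diff assms)

text \<open>The martingale-difference property in weak form; it rests on \<open>v k\<close> being
  known before the seed is drawn.\<close>

lemma quantization_error_mean:
  assumes k: "k < K" and "f \<in> borel_measurable (\<G> k)" "square_integrable f"
  shows "(\<integral>x. (q k x - v k x) \<bullet> f x \<partial>M) = 0"
  unfolding q_def by (rule quantization_unbiased[OF k v_\<G>[OF k] v_sq[OF k] assms(2,3)])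

text \<open>Bounded Lipschitz continuity compares the operator at \<open>zhalf k\<close> and
  \<open>w k\<close>. The distance of these points is a step length with negative sign in the
  descent inequality, so only \<open>D\<^sup>2\<close> is left over.\<close>

lemma q_second_moment:
  assumes k: "k < K"
  shows "(\<integral>x. (norm (q k x))\<^sup>2 \<partial>M) \<le> \<omega> * (L\<^sup>2 * (\<integral>x. (norm (w k x - zhalf k x))\<^sup>2 \<partial>M) + D\<^sup>2)"
proof -
  have int: "integrable M (\<lambda>x. (norm (w k x - zhalf k x))\<^sup>2)"
    using k by (intro norm_diff_integrable w_sq zhalf_sq) auto
  have "(\<integral>x. (norm (v k x))\<^sup>2 \<partial>M) \<le> (\<integral>x. L\<^sup>2 * (norm (w k x - zhalf k x))\<^sup>2 + D\<^sup>2 \<partial>M)"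
  proof (rule integral_mono)
    show "integrable M (\<lambda>x. (norm (v k x))\<^sup>2)" using k by (intro square_integrable_norm v_sq)
    show "integrable M (\<lambda>x. L\<^sup>2 * (norm (w k x - zhalf k x))\<^sup>2 + D\<^sup>2)" using int by simp
    show "(norm (v k x))\<^sup>2 \<le> L\<^sup>2 * (norm (w k x - zhalf k x))\<^sup>2 + D\<^sup>2" if "x \<in> space M" for x
      using F_lipschitz w_Z[of k x] zhalf_dom[OF k that] dom_Z k that
      unfolding boundedly_lipschitz_def v_def norm_minus_commute[of "w k x"] by auto
  qed
  also have "\<dots> = L\<^sup>2 * (\<integral>x. (norm (w k x - zhalf k x))\<^sup>2 \<partial>M) + D\<^sup>2"
    using int by (simp add: prob_space)
  finally show ?thesis
    unfolding q_def quantization_step(2)[OF k v_\<G>[OF k] v_sq[OF k]]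
    by (intro mult_left_mono \<omega>_nonneg)
qed

text \<open>\<open>f\<close> also takes the sample point, so that distances to random centres and
  inner products with past variables can be averaged over the coin.\<close>

lemma w_Suc_integral:
  fixes f :: "'m \<Rightarrow> 'a \<Rightarrow> real"
  assumes k: "k < K" and "(\<lambda>x. f x (z (Suc k) x)) \<in> borel_measurable (\<H> k)" "(\<lambda>x. f x (w k x)) \<in> borel_measurable (\<H> k)"
    and "integrable M (\<lambda>x. f x (z (Suc k) x))" "integrable M (\<lambda>x. f x (w k x))"
  shows "integrable M (\<lambda>x. f x (w (Suc k) x))"
    and "(\<integral>x. f x (w (Suc k) x) \<partial>M) = (1 - \<tau>) * (\<integral>x. f x (z (Suc k) x) \<partial>M) + \<tau> * (\<integral>x. f x (w k x) \<partial>M)"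
proof -
  note c = coin_integral[OF k assms(2,4,3,5)]
  have e: "f x (w (Suc k) x) = (if b k x then f x (z (Suc k) x) else f x (w k x))" if "x \<in> space M" for x
    using w_Suc[OF k that] by simp
  show "integrable M (\<lambda>x. f x (w (Suc k) x))"
    by (subst Bochner_Integration.integrable_cong[OF refl e]) (use c in auto)
  show "(\<integral>x. f x (w (Suc k) x) \<partial>M) = (1 - \<tau>) * (\<integral>x. f x (z (Suc k) x) \<partial>M) + \<tau> * (\<integral>x. f x (w k x) \<partial>M)"
    by (subst Bochner_Integration.integral_cong[OF refl e]) (use c in auto)
qed

lemma w_Suc_distance:
  assumes k: "k < K"
  shows "(\<integral>x. (norm (w (Suc k) x - u))\<^sup>2 \<partial>M)
    = (1 - \<tau>) * (\<integral>x. (norm (z (Suc k) x - u))\<^sup>2 \<partial>M) + \<tau> * (\<integral>x. (norm (w k x - u))\<^sup>2 \<partial>M)"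
proof (rule w_Suc_integral(2)[OF k, where f="\<lambda>_ y. (norm (y - u))\<^sup>2"])
  note [measurable] = z_\<H>[OF k] w_\<H>[OF k]
  show "(\<lambda>x. (norm (z (Suc k) x - u))\<^sup>2) \<in> borel_measurable (\<H> k)"
    "(\<lambda>x. (norm (w k x - u))\<^sup>2) \<in> borel_measurable (\<H> k)" by measurable
qed (use k in \<open>auto intro!: norm_diff_integrable z_sq w_sq square_integrable_const\<close>)

end

section \<open>The strongly monotone case\<close>

context quant_ES_run
begin

text \<open>With \<open>c = \<gamma> * (\<mu>F + \<mu>h)\<close>, the mean one-step inequality gains
  \<open>c * G + \<tau> * H + (1 - \<tau>) * J\<close>; the quantization variance uses up an eighth
  of the last term. The rest must pay for a fraction of the potential, so \<open>A\<close> and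
  \<open>B\<close> are split at \<open>zhalf k\<close> at the cost of a factor 2. The fraction
  \<open>c / 4\<close> fits.\<close>

lemma strongly_monotone_contraction:
  assumes k: "k < K" and mon: "strongly_monotone_problem F h Z \<mu>F \<mu>h"
    and \<mu>: "0 \<le> \<mu>F" "0 \<le> \<mu>h" and zs: "vi_solution F h Z zs"
    and \<gamma>1: "8 * \<gamma>\<^sup>2 * L\<^sup>2 * \<omega> \<le> 1 - \<tau>" and \<gamma>2: "4 * \<gamma> * (\<mu>F + \<mu>h) \<le> 1 - \<tau>"
  shows "\<tau> * (\<integral>x. (norm (z (Suc k) x - zs))\<^sup>2 \<partial>M) + (\<integral>x. (norm (w (Suc k) x - zs))\<^sup>2 \<partial>M)
    \<le> (1 - \<gamma> * (\<mu>F + \<mu>h) / 4) * (\<tau> * (\<integral>x. (norm (z k x - zs))\<^sup>2 \<partial>M) + (\<integral>x. (norm (w k x - zs))\<^sup>2 \<partial>M))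
      + \<gamma>\<^sup>2 * \<omega> * D\<^sup>2"
proof -
  define \<mu> where "\<mu> = \<mu>F + \<mu>h"
  note zs_dom = vi_solution_subgradient(1)[OF zs dom_Z]
  note sub = vi_solution_subgradient(2)[OF zs dom_Z]
  have sq: "square_integrable (z k)" "square_integrable (w k)" "square_integrable (zhalf k)"
    "square_integrable (z (Suc k))" "square_integrable (q k)" "square_integrable (v k)"
    using k by (auto intro: z_sq w_sq zhalf_sq q_sq v_sq)
  note cs = square_integrable_const[of zs]
  note int = norm_diff_integrable[OF sq(1) cs] norm_diff_integrable[OF sq(2) cs]
    norm_diff_integrable[OF sq(3) cs] norm_diff_integrable[OF sq(4) cs]
    norm_diff_integrable[OF sq(1,3)] norm_diff_integrable[OF sq(2,3)]
    square_integrable_norm[OF sq(5)]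
    square_integrable_inner[OF square_integrable_diff[OF sq(5,6)] square_integrable_diff[OF sq(3) cs]]
  have pointwise: "(norm (z (Suc k) x - zs))\<^sup>2 + \<gamma> * \<mu> * (norm (zhalf k x - zs))\<^sup>2
      + 2 * \<gamma> * ((q k x - v k x) \<bullet> (zhalf k x - zs))
    \<le> \<tau> * (norm (z k x - zs))\<^sup>2 + (1 - \<tau>) * (norm (w k x - zs))\<^sup>2 - \<tau> * (norm (z k x - zhalf k x))\<^sup>2
      - (1 - \<tau>) * (norm (w k x - zhalf k x))\<^sup>2 + \<gamma>\<^sup>2 * (norm (q k x))\<^sup>2"
    if x: "x \<in> space M" for x
  proof -
    let ?zh = "zhalf k x" and ?zp = "z (Suc k) x"
    have zh: "?zh \<in> dom_h" by (rule zhalf_dom[OF k x])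
    note step = extragradient_step[OF \<gamma> mon dom_Z zs_dom zhalf_eq[OF k x] z_Suc[OF k x]]
    have "(F ?zh - F zs) \<bullet> (?zh - zs) \<ge> \<mu>F * (norm (?zh - zs))\<^sup>2"
      using mon zh zs_dom dom_Z unfolding strongly_monotone_problem_def by blast
    moreover have "h ?zh - h zs - ereal (- F zs \<bullet> (?zh - zs)) \<ge> ereal (\<mu>h / 2 * (norm (?zh - zs))\<^sup>2)"
      using mon sub zh zs_dom dom_Z unfolding strongly_monotone_problem_def by blast
    then have "\<mu>h / 2 * (norm (?zh - zs))\<^sup>2 \<le> hr ?zh - hr zs + F zs \<bullet> (?zh - zs)"
      using zh zs_dom by (simp add: h_eq)
    ultimately have "(\<mu>F + \<mu>h / 2) * (norm (?zh - zs))\<^sup>2 \<le> F ?zh \<bullet> (?zh - zs) + hr ?zh - hr zs"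
      by (simp add: inner_diff_left algebra_simps)
    then have "2 * \<gamma> * ((\<mu>F + \<mu>h / 2) * (norm (?zh - zs))\<^sup>2) \<le> 2 * \<gamma> * (F ?zh \<bullet> (?zh - zs) + hr ?zh - hr zs)"
      using \<gamma> by (intro mult_left_mono) auto
    moreover have "\<gamma> * \<mu> * (norm (?zh - zs))\<^sup>2 \<le> 2 * \<gamma> * ((\<mu>F + \<mu>h / 2) * (norm (?zh - zs))\<^sup>2)"
      using \<gamma> \<mu> by (simp add: \<mu>_def algebra_simps)
    moreover have "(q k x + F (w k x)) \<bullet> (?zh - zs) = F ?zh \<bullet> (?zh - zs) + (q k x - v k x) \<bullet> (?zh - zs)"
      by (simp add: v_def inner_diff_left inner_add_left)
    \<comment> \<open>Young's inequality with weight 1 spends the whole last step length on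
      \<open>q\<close>.\<close>
    moreover have "2 * \<gamma> * (q k x \<bullet> (?zh - ?zp)) \<le> \<gamma>\<^sup>2 * (norm (q k x))\<^sup>2 + (norm (?zp - ?zh))\<^sup>2"
      using two_inner_le_weighted[of 1 "\<gamma> *\<^sub>R q k x" "?zh - ?zp"]
      by (simp add: power_mult_distrib norm_minus_commute)
    moreover have "0 \<le> \<gamma> * \<mu>h * ((norm (?zp - zs))\<^sup>2 + (norm (?zp - ?zh))\<^sup>2)" using \<gamma> \<mu> by simp
    ultimately show ?thesis using step by (simp add: distrib_left right_diff_distrib)
  qed
  define A B G H J q2 A' where "A = (\<integral>x. (norm (z k x - zs))\<^sup>2 \<partial>M)" and "B = (\<integral>x. (norm (w k x - zs))\<^sup>2 \<partial>M)"
    and "G = (\<integral>x. (norm (zhalf k x - zs))\<^sup>2 \<partial>M)" and "H = (\<integral>x. (norm (z k x - zhalf k x))\<^sup>2 \<partial>M)"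
    and "J = (\<integral>x. (norm (w k x - zhalf k x))\<^sup>2 \<partial>M)" and "q2 = (\<integral>x. (norm (q k x))\<^sup>2 \<partial>M)"
    and "A' = (\<integral>x. (norm (z (Suc k) x - zs))\<^sup>2 \<partial>M)"
  note defs = A_def B_def G_def H_def J_def q2_def A'_def
  have nonneg: "0 \<le> G" "0 \<le> H" "0 \<le> J" by (simp_all add: defs)
  have "(\<integral>x. (q k x - v k x) \<bullet> (zhalf k x - zs) \<partial>M) = 0"
    by (intro quantization_error_mean[OF k] borel_measurable_diff zhalf_\<G>[OF k] borel_measurable_const
        square_integrable_diff sq cs)
  moreover have "(\<integral>x. (norm (z (Suc k) x - zs))\<^sup>2 + \<gamma> * \<mu> * (norm (zhalf k x - zs))\<^sup>2
      + 2 * \<gamma> * ((q k x - v k x) \<bullet> (zhalf k x - zs)) \<partial>M)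
    \<le> (\<integral>x. \<tau> * (norm (z k x - zs))\<^sup>2 + (1 - \<tau>) * (norm (w k x - zs))\<^sup>2 - \<tau> * (norm (z k x - zhalf k x))\<^sup>2
      - (1 - \<tau>) * (norm (w k x - zhalf k x))\<^sup>2 + \<gamma>\<^sup>2 * (norm (q k x))\<^sup>2 \<partial>M)"
    by (rule integral_mono) (use pointwise int in auto)
  ultimately have 1: "A' + \<gamma> * \<mu> * G \<le> \<tau> * A + (1 - \<tau>) * B - \<tau> * H - (1 - \<tau>) * J + \<gamma>\<^sup>2 * q2"
    using int by (simp add: defs)
  have "A \<le> (\<integral>x. 2 * (norm (z k x - zhalf k x))\<^sup>2 + 2 * (norm (zhalf k x - zs))\<^sup>2 \<partial>M)"
    unfolding A_def by (rule integral_mono) (use int norm_diff_triangle_square in auto)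
  then have 2: "A \<le> 2 * H + 2 * G" using int by (simp add: defs)
  have "B \<le> (\<integral>x. 2 * (norm (w k x - zhalf k x))\<^sup>2 + 2 * (norm (zhalf k x - zs))\<^sup>2 \<partial>M)"
    unfolding B_def by (rule integral_mono) (use int norm_diff_triangle_square in auto)
  then have 3: "B \<le> 2 * J + 2 * G" using int by (simp add: defs)
  have "\<gamma>\<^sup>2 * q2 \<le> \<gamma>\<^sup>2 * (\<omega> * (L\<^sup>2 * J + D\<^sup>2))"
    unfolding q2_def J_def by (intro mult_left_mono q_second_moment[OF k]) simp
  also have "\<dots> = 8 * \<gamma>\<^sup>2 * L\<^sup>2 * \<omega> * J / 8 + \<gamma>\<^sup>2 * \<omega> * D\<^sup>2" by (simp add: algebra_simps)
  also have "\<dots> \<le> (1 - \<tau>) * J / 8 + \<gamma>\<^sup>2 * \<omega> * D\<^sup>2"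
    using mult_right_mono[OF \<gamma>1 nonneg(3)] by simp
  finally have 4: "\<gamma>\<^sup>2 * q2 \<le> (1 - \<tau>) * J / 8 + \<gamma>\<^sup>2 * \<omega> * D\<^sup>2" .
  \<comment> \<open>Two bounds on \<open>c\<close> are used: at most 1/4 to charge the
    \<open>H\<close> part, and \<open>4 * c \<le> 1 - \<tau>\<close> to charge the \<open>J\<close>
    part.\<close>
  define c where "c = \<gamma> * \<mu>"
  have c: "0 \<le> c" "4 * c \<le> 1 - \<tau>" "c \<le> 1 / 4" using \<gamma> \<mu> \<gamma>2 \<tau> by (auto simp: c_def \<mu>_def algebra_simps)
  have "c / 4 * (\<tau> * A + B) \<le> c / 4 * (\<tau> * (2 * H + 2 * G) + (2 * J + 2 * G))"
    using 2 3 c \<tau> by (intro mult_left_mono add_mono) auto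
  moreover have "c * (\<tau> * H) \<le> 1 / 4 * (\<tau> * H)" using c nonneg \<tau> by (intro mult_right_mono) auto
  moreover have "4 * c * J \<le> (1 - \<tau>) * J" using c nonneg by (intro mult_right_mono) auto
  moreover have "c * (\<tau> * G) \<le> c * (1 * G)" using c nonneg \<tau> by (intro mult_left_mono mult_right_mono) auto
  moreover have "0 \<le> \<tau> * H" "0 \<le> (1 - \<tau>) * J" using \<tau> nonneg by auto
  moreover have "c / 4 * (\<tau> * (2 * H + 2 * G) + (2 * J + 2 * G))
      = c * (\<tau> * H) / 2 + c * (\<tau> * G) / 2 + 4 * c * J / 8 + c * (1 * G) / 2"
    by (simp add: algebra_simps)
  ultimately have 5: "c / 4 * (\<tau> * A + B) \<le> c * (1 * G) + \<tau> * H + 7 / 8 * ((1 - \<tau>) * J)"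
    by linarith
  have "\<tau> * A' + (\<integral>x. (norm (w (Suc k) x - zs))\<^sup>2 \<partial>M) = A' + \<tau> * B"
    unfolding w_Suc_distance[OF k] defs[symmetric] by (simp add: algebra_simps)
  also have "\<dots> \<le> (1 - c / 4) * (\<tau> * A + B) + \<gamma>\<^sup>2 * \<omega> * D\<^sup>2"
    using 1 4 5 unfolding c_def[symmetric] left_diff_distrib[of 1 "c / 4"] left_diff_distrib[of 1 \<tau> B] mult_1
    by linarith
  finally show ?thesis by (simp add: defs c_def \<mu>_def)
qed

lemma strongly_monotone_rate:
  assumes mon: "strongly_monotone_problem F h Z \<mu>F \<mu>h"
    and \<mu>: "0 \<le> \<mu>F" "0 \<le> \<mu>h" "0 < \<mu>F + \<mu>h" and zs: "vi_solution F h Z zs"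
    and \<gamma>1: "8 * \<gamma>\<^sup>2 * L\<^sup>2 * \<omega> \<le> 1 - \<tau>" and \<gamma>2: "4 * \<gamma> * (\<mu>F + \<mu>h) \<le> 1 - \<tau>"
    and k: "k \<le> K"
  shows "\<tau> * (\<integral>x. (norm (z k x - zs))\<^sup>2 \<partial>M) + (\<integral>x. (norm (w k x - zs))\<^sup>2 \<partial>M)
    \<le> (1 - \<gamma> * (\<mu>F + \<mu>h) / 4) ^ k * (\<tau> * (norm (z0 - zs))\<^sup>2 + (norm (z0 - zs))\<^sup>2)
      + 4 * \<gamma> * \<omega> * D\<^sup>2 / (\<mu>F + \<mu>h)"
  using k
proof (induction k)
  case 0
  have "(\<integral>x. (norm (z 0 x - zs))\<^sup>2 \<partial>M) = (norm (z0 - zs))\<^sup>2"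
    by (subst Bochner_Integration.integral_cong[OF refl, of _ _ "\<lambda>_. (norm (z0 - zs))\<^sup>2"]) (simp_all add: start prob_space)
  moreover have "(\<integral>x. (norm (w 0 x - zs))\<^sup>2 \<partial>M) = (norm (z0 - zs))\<^sup>2"
    by (subst Bochner_Integration.integral_cong[OF refl, of _ _ "\<lambda>_. (norm (z0 - zs))\<^sup>2"]) (simp_all add: start prob_space)
  ultimately show ?case using \<gamma> \<mu> \<omega>_nonneg by simp
next
  case (Suc k)
  define c where "c = \<gamma> * (\<mu>F + \<mu>h) / 4"
  define V0 where "V0 = \<tau> * (norm (z0 - zs))\<^sup>2 + (norm (z0 - zs))\<^sup>2"
  \<comment> \<open>The fixed point of the recursion:
    \<open>(1 - c) * e + \<gamma>\<^sup>2 * \<omega> * D\<^sup>2 = e\<close>.\<close>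
  define e where "e = 4 * \<gamma> * \<omega> * D\<^sup>2 / (\<mu>F + \<mu>h)"
  have c: "0 \<le> 1 - c" using \<gamma>2 \<tau> by (simp add: c_def)
  have ce: "c * e = \<gamma>\<^sup>2 * \<omega> * D\<^sup>2" using \<mu> by (simp add: c_def e_def field_simps power2_eq_square)
  have "\<tau> * (\<integral>x. (norm (z (Suc k) x - zs))\<^sup>2 \<partial>M) + (\<integral>x. (norm (w (Suc k) x - zs))\<^sup>2 \<partial>M)
    \<le> (1 - c) * (\<tau> * (\<integral>x. (norm (z k x - zs))\<^sup>2 \<partial>M) + (\<integral>x. (norm (w k x - zs))\<^sup>2 \<partial>M)) + c * e"
    unfolding ce unfolding c_def using Suc.prems
    by (intro strongly_monotone_contraction[OF _ mon \<mu>(1,2) zs \<gamma>1 \<gamma>2]) simp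
  also have "\<dots> \<le> (1 - c) * ((1 - c) ^ k * V0 + e) + c * e"
    using Suc.IH Suc.prems unfolding c_def[symmetric] V0_def[symmetric] e_def[symmetric]
    by (intro add_right_mono mult_left_mono c) simp
  also have "\<dots> = (1 - c) ^ Suc k * V0 + e" by (simp add: algebra_simps)
  finally show ?case by (simp add: c_def V0_def e_def)
qed

end

section \<open>The monotone case\<close>

context quant_ES_run
begin

text \<open>In the one-step inequality the reference point \<open>u\<close> meets the randomness only through the
  inner product of \<open>u - z0\<close> with \<open>noise\<close>; the terms not involving \<open>u\<close> are collected in
  \<open>remainder\<close>, which has mean zero apart from its last three summands.\<close>
definition coin_noise :: "nat \<Rightarrow> 'm \<Rightarrow> 'a" where
  "coin_noise k x = w (Suc k) x - \<tau> *\<^sub>R w k x - (1 - \<tau>) *\<^sub>R z (Suc k) x"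

definition noise :: "nat \<Rightarrow> 'm \<Rightarrow> 'a" where
  "noise k x = (2 * \<gamma>) *\<^sub>R (q k x - v k x) - 2 *\<^sub>R coin_noise k x"

definition noise_sum :: "nat \<Rightarrow> 'm \<Rightarrow> 'a" where
  "noise_sum n x = (\<Sum>k<n. noise k x)"

definition remainder :: "nat \<Rightarrow> 'm \<Rightarrow> real" where
  "remainder k x = (norm (w (Suc k) x - z0))\<^sup>2 - \<tau> * (norm (w k x - z0))\<^sup>2 - (1 - \<tau>) * (norm (z (Suc k) x - z0))\<^sup>2
    - 2 * \<gamma> * ((q k x - v k x) \<bullet> (zhalf k x - z0))
    + 2 * \<gamma>\<^sup>2 * (norm (q k x))\<^sup>2 - (norm (z (Suc k) x - zhalf k x))\<^sup>2 / 2 - (1 - \<tau>) * (norm (w k x - zhalf k x))\<^sup>2"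

lemma coin_noise_sq: "k < K \<Longrightarrow> square_integrable (coin_noise k)"
  unfolding coin_noise_def[abs_def]
  by (intro square_integrable_diff square_integrable_scaleR z_sq w_sq) auto

lemma noise_sq: "k < K \<Longrightarrow> square_integrable (noise k)"
  unfolding noise_def[abs_def]
  by (intro square_integrable_diff square_integrable_scaleR q_sq v_sq coin_noise_sq)

lemma noise_\<G>:
  assumes k: "k < K"
  shows "noise k \<in> borel_measurable (\<G> (Suc k))"
proof -
  have [measurable]: "v k \<in> borel_measurable (\<G> (Suc k))"
    using \<H>_\<G>[OF \<G>_\<H>[OF v_\<G>[OF k] k] k] by simp
  have [measurable]: "q k \<in> borel_measurable (\<G> (Suc k))" "w k \<in> borel_measurable (\<G> (Suc k))"
    "z (Suc k) \<in> borel_measurable (\<G> (Suc k))"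
    using \<H>_\<G>[OF q_\<H>[OF k] k] \<H>_\<G>[OF w_\<H>[OF k] k] \<H>_\<G>[OF z_\<H>[OF k] k] by simp_all
  have [measurable]: "w (Suc k) \<in> borel_measurable (\<G> (Suc k))" using k by (intro w_\<G>) simp
  show ?thesis unfolding noise_def[abs_def] coin_noise_def by measurable
qed

lemma noise_sum_\<G>: "n \<le> K \<Longrightarrow> noise_sum n \<in> borel_measurable (\<G> n) \<and> square_integrable (noise_sum n)"
proof (induction n)
  case 0
  then show ?case by (simp add: noise_sum_def[abs_def] square_integrable_const)
next
  case (Suc n)
  then have n: "n < K" and IH: "noise_sum n \<in> borel_measurable (\<G> n)" "square_integrable (noise_sum n)" by simp_all
  have eq: "noise_sum (Suc n) = (\<lambda>x. noise_sum n x + noise n x)" by (simp add: noise_sum_def fun_eq_iff)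
  have [measurable]: "noise_sum n \<in> borel_measurable (\<G> (Suc n))"
    using \<H>_\<G>[OF \<G>_\<H>[OF IH(1) n] n] by simp
  note [measurable] = noise_\<G>[OF n]
  have "(\<lambda>x. noise_sum n x + noise n x) \<in> borel_measurable (\<G> (Suc n))" by measurable
  then show ?case
    unfolding eq using square_integrable_add[OF IH(2) noise_sq[OF n]] by simp
qed

lemma coin_noise_mean:
  assumes k: "k < K" and f: "f \<in> borel_measurable (\<G> k)" "square_integrable f"
  shows "(\<integral>x. f x \<bullet> coin_noise k x \<partial>M) = 0"
proof -
  have k': "k \<le> K" "Suc k \<le> K" using k by auto
  have [measurable]: "f \<in> borel_measurable (\<H> k)" using \<G>_\<H>[OF f(1) k] by simp
  note [measurable] = z_\<H>[OF k] w_\<H>[OF k]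
  note int = square_integrable_inner[OF f(2) z_sq[OF k'(2)]] square_integrable_inner[OF f(2) w_sq[OF k'(1)]]
    square_integrable_inner[OF f(2) w_sq[OF k'(2)]]
  have "(\<integral>x. f x \<bullet> w (Suc k) x \<partial>M) = (1 - \<tau>) * (\<integral>x. f x \<bullet> z (Suc k) x \<partial>M) + \<tau> * (\<integral>x. f x \<bullet> w k x \<partial>M)"
    by (rule w_Suc_integral(2)[OF k _ _ int(1,2)]) measurable
  then show ?thesis
    using int by (simp add: coin_noise_def inner_diff_right)
qed

text \<open>The variance of a two-point variable is \<tau>(1 - \<tau>) times the squared distance of
  its values. Splitting that distance at \<open>zhalf k\<close> produces the step lengths that
  \<open>remainder\<close> subtracts.\<close>

lemma coin_noise_square:
  assumes k: "k < K"
  shows "(\<integral>x. (norm (coin_noise k x))\<^sup>2 \<partial>M)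
    \<le> (1 - \<tau>) * (2 * (\<integral>x. (norm (z (Suc k) x - zhalf k x))\<^sup>2 \<partial>M) + 2 * (\<integral>x. (norm (w k x - zhalf k x))\<^sup>2 \<partial>M))"
proof -
  have sq: "square_integrable (z (Suc k))" "square_integrable (w k)" "square_integrable (zhalf k)"
    using k by (auto intro: z_sq w_sq zhalf_sq)
  note int = norm_diff_integrable[OF sq(1,2)] norm_diff_integrable[OF sq(1,3)] norm_diff_integrable[OF sq(2,3)]
  note [measurable] = z_\<H>[OF k] w_\<H>[OF k]
  define d where "d x = (norm (z (Suc k) x - w k x))\<^sup>2" for x
  \<comment> \<open>The coin noise has two values: this one on success, the next one on
    failure.\<close>
  have zd: "(norm (z (Suc k) x - \<tau> *\<^sub>R w k x - (1 - \<tau>) *\<^sub>R z (Suc k) x))\<^sup>2 = \<tau>\<^sup>2 * d x" for x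
  proof -
    have "z (Suc k) x - \<tau> *\<^sub>R w k x - (1 - \<tau>) *\<^sub>R z (Suc k) x = \<tau> *\<^sub>R (z (Suc k) x - w k x)"
      by (simp add: algebra_simps)
    then show ?thesis by (simp add: d_def power_mult_distrib)
  qed
  have wd: "(norm (w k x - \<tau> *\<^sub>R w k x - (1 - \<tau>) *\<^sub>R z (Suc k) x))\<^sup>2 = (1 - \<tau>)\<^sup>2 * d x" for x
  proof -
    have "w k x - \<tau> *\<^sub>R w k x - (1 - \<tau>) *\<^sub>R z (Suc k) x = (1 - \<tau>) *\<^sub>R (w k x - z (Suc k) x)"
      by (simp add: algebra_simps)
    then show ?thesis by (simp add: d_def power_mult_distrib norm_minus_commute)
  qed
  have [simp]: "integrable M d" unfolding d_def[abs_def] by (rule int)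
  have [measurable]: "d \<in> borel_measurable (\<H> k)" unfolding d_def[abs_def] by measurable
  have "(\<integral>x. (norm (coin_noise k x))\<^sup>2 \<partial>M)
    = (1 - \<tau>) * (\<integral>x. \<tau>\<^sup>2 * d x \<partial>M) + \<tau> * (\<integral>x. (1 - \<tau>)\<^sup>2 * d x \<partial>M)"
    unfolding coin_noise_def zd[symmetric] wd[symmetric]
    by (rule w_Suc_integral(2)[OF k, where f="\<lambda>x y. (norm (y - \<tau> *\<^sub>R w k x - (1 - \<tau>) *\<^sub>R z (Suc k) x))\<^sup>2"])
      (simp_all only: zd wd, simp_all)
  also have "\<dots> = (1 - \<tau>) * (\<tau> * (\<integral>x. d x \<partial>M))"
    by (simp add: algebra_simps power2_eq_square)
  also have "\<dots> \<le> (1 - \<tau>) * (1 * (\<integral>x. d x \<partial>M))"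
    using \<tau> by (intro mult_left_mono mult_right_mono) (auto simp: d_def)
  also have "(\<integral>x. d x \<partial>M) \<le> (\<integral>x. 2 * (norm (z (Suc k) x - zhalf k x))\<^sup>2 + 2 * (norm (w k x - zhalf k x))\<^sup>2 \<partial>M)"
  proof (rule integral_mono)
    show "d x \<le> 2 * (norm (z (Suc k) x - zhalf k x))\<^sup>2 + 2 * (norm (w k x - zhalf k x))\<^sup>2" for x
      unfolding d_def using norm_diff_triangle_square[of "z (Suc k) x" "w k x" "zhalf k x"]
      by (simp add: norm_minus_commute)
  qed (use int in auto)
  also have "\<dots> = 2 * (\<integral>x. (norm (z (Suc k) x - zhalf k x))\<^sup>2 \<partial>M) + 2 * (\<integral>x. (norm (w k x - zhalf k x))\<^sup>2 \<partial>M)"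
    using int by simp
  finally show ?thesis using \<tau> by simp
qed

lemma remainder_integrable:
  assumes k: "k < K"
  shows "integrable M (remainder k)"
  unfolding remainder_def[abs_def] using k
  by (intro Bochner_Integration.integrable_diff Bochner_Integration.integrable_add integrable_mult_right
      integrable_divide norm_diff_integrable square_integrable_norm square_integrable_inner
      square_integrable_diff q_sq v_sq z_sq w_sq zhalf_sq square_integrable_const) auto

text \<open>In mean, 1/32 of the squared noise costs a quarter of
  \<open>\<gamma>\<^sup>2 * q2\<close> and at most \<open>N / 2 + (1 - \<tau>) * J / 2\<close>,
  while \<open>remainder\<close> amounts to
  \<open>2 * \<gamma>\<^sup>2 * q2 - N / 2 - (1 - \<tau>) * J\<close>. So \<open>N\<close> is
  covered, half of the \<open>J\<close> term is left for the variance, and the variance carries the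
  factor 2 + 1/4 = 9/4.\<close>

lemma noise_step:
  assumes k: "k < K" and \<gamma>1: "16 * \<gamma>\<^sup>2 * L\<^sup>2 * \<omega> \<le> 1 - \<tau>"
  shows "(\<integral>x. (norm (noise_sum (Suc k) x))\<^sup>2 \<partial>M) / 32 + (\<integral>x. remainder k x \<partial>M)
    \<le> (\<integral>x. (norm (noise_sum k x))\<^sup>2 \<partial>M) / 32 + 9 / 4 * \<gamma>\<^sup>2 * \<omega> * D\<^sup>2"
proof -
  have sq: "square_integrable (z (Suc k))" "square_integrable (w k)" "square_integrable (zhalf k)"
    "square_integrable (q k)" "square_integrable (v k)" "square_integrable (w (Suc k))"
    using k by (auto intro: z_sq w_sq zhalf_sq q_sq v_sq)
  note cs = square_integrable_const[of z0]
  have ns: "noise_sum k \<in> borel_measurable (\<G> k)" "square_integrable (noise_sum k)"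
    using noise_sum_\<G>[of k] k by auto
  define N J q2 where "N = (\<integral>x. (norm (z (Suc k) x - zhalf k x))\<^sup>2 \<partial>M)"
    and "J = (\<integral>x. (norm (w k x - zhalf k x))\<^sup>2 \<partial>M)" and "q2 = (\<integral>x. (norm (q k x))\<^sup>2 \<partial>M)"
  have nonneg: "0 \<le> N" "0 \<le> J" by (simp_all add: N_def J_def)
  have \<delta>: "square_integrable (\<lambda>x. q k x - v k x)" by (intro square_integrable_diff sq)
  note cn = coin_noise_sq[OF k]
  \<comment> \<open>A variance is at most the second moment, since the cross term with
    \<open>v k\<close> vanishes in mean.\<close>
  have \<delta>2: "(\<integral>x. (norm (q k x - v k x))\<^sup>2 \<partial>M) \<le> q2"
  proof -
    have "(norm (q k x - v k x))\<^sup>2 = (norm (q k x))\<^sup>2 - (norm (v k x))\<^sup>2 - 2 * ((q k x - v k x) \<bullet> v k x)" for x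
      unfolding power2_norm_eq_inner by (simp add: inner_diff inner_commute)
    then have "(\<integral>x. (norm (q k x - v k x))\<^sup>2 \<partial>M)
      = q2 - (\<integral>x. (norm (v k x))\<^sup>2 \<partial>M) - 2 * (\<integral>x. (q k x - v k x) \<bullet> v k x \<partial>M)"
      using square_integrable_norm[OF sq(4)] square_integrable_norm[OF sq(5)] square_integrable_inner[OF \<delta> sq(5)]
      by (simp add: q2_def)
    then show ?thesis using quantization_error_mean[OF k v_\<G>[OF k] sq(5)] by simp
  qed
  have "(\<integral>x. (norm (noise k x))\<^sup>2 \<partial>M)
    \<le> (\<integral>x. 8 * \<gamma>\<^sup>2 * (norm (q k x - v k x))\<^sup>2 + 8 * (norm (coin_noise k x))\<^sup>2 \<partial>M)"
  proof (rule integral_mono)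
    show "(norm (noise k x))\<^sup>2 \<le> 8 * \<gamma>\<^sup>2 * (norm (q k x - v k x))\<^sup>2 + 8 * (norm (coin_noise k x))\<^sup>2" for x
      using norm_sum_square_le[of "(2 * \<gamma>) *\<^sub>R (q k x - v k x)" "- 2 *\<^sub>R coin_noise k x"]
      by (simp add: noise_def power_mult_distrib)
  qed (use square_integrable_norm[OF noise_sq[OF k]] square_integrable_norm[OF \<delta>] square_integrable_norm[OF cn] in auto)
  also have "\<dots> = 8 * \<gamma>\<^sup>2 * (\<integral>x. (norm (q k x - v k x))\<^sup>2 \<partial>M) + 8 * (\<integral>x. (norm (coin_noise k x))\<^sup>2 \<partial>M)"
    using square_integrable_norm[OF \<delta>] square_integrable_norm[OF cn] by simp
  also have "\<dots> \<le> 8 * \<gamma>\<^sup>2 * q2 + 8 * ((1 - \<tau>) * (2 * N + 2 * J))"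
    using \<delta>2 coin_noise_square[OF k] unfolding N_def J_def by (intro add_mono mult_left_mono) auto
  finally have noise2: "(\<integral>x. (norm (noise k x))\<^sup>2 \<partial>M) \<le> 8 * \<gamma>\<^sup>2 * q2 + 16 * ((1 - \<tau>) * N) + 16 * ((1 - \<tau>) * J)"
    by (simp add: algebra_simps)
  \<comment> \<open>Orthogonality of martingale differences: \<open>noise_sum k\<close> is known
    before step \<open>k\<close>.\<close>
  have cross: "(\<integral>x. noise_sum k x \<bullet> noise k x \<partial>M) = 0"
  proof -
    have "noise_sum k x \<bullet> noise k x = 2 * \<gamma> * ((q k x - v k x) \<bullet> noise_sum k x) - 2 * (noise_sum k x \<bullet> coin_noise k x)" for x
      by (simp add: noise_def inner_diff_right inner_commute)
    then show ?thesis
      using square_integrable_inner[OF \<delta> ns(2)] square_integrable_inner[OF ns(2) cn]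
        quantization_error_mean[OF k ns] coin_noise_mean[OF k ns] by simp
  qed
  have "(norm (noise_sum (Suc k) x))\<^sup>2 = (norm (noise_sum k x))\<^sup>2 + (norm (noise k x))\<^sup>2 + 2 * (noise_sum k x \<bullet> noise k x)" for x
    unfolding power2_norm_eq_inner by (simp add: noise_sum_def inner_add inner_commute)
  then have sum2: "(\<integral>x. (norm (noise_sum (Suc k) x))\<^sup>2 \<partial>M) = (\<integral>x. (norm (noise_sum k x))\<^sup>2 \<partial>M) + (\<integral>x. (norm (noise k x))\<^sup>2 \<partial>M)"
    using square_integrable_norm[OF ns(2)] square_integrable_norm[OF noise_sq[OF k]]
      square_integrable_inner[OF ns(2) noise_sq[OF k]] cross by simp
  have "(\<integral>x. (q k x - v k x) \<bullet> (zhalf k x - z0) \<partial>M) = 0"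
    by (intro quantization_error_mean[OF k] borel_measurable_diff zhalf_\<G>[OF k] borel_measurable_const
        square_integrable_diff sq cs)
  then have rem: "(\<integral>x. remainder k x \<partial>M) = 2 * \<gamma>\<^sup>2 * q2 - N / 2 - (1 - \<tau>) * J"
    unfolding remainder_def N_def J_def q2_def
    using norm_diff_integrable[OF sq(6) cs] norm_diff_integrable[OF sq(2) cs] norm_diff_integrable[OF sq(1) cs]
      square_integrable_inner[OF \<delta> square_integrable_diff[OF sq(3) cs]] square_integrable_norm[OF sq(4)]
      norm_diff_integrable[OF sq(1,3)] norm_diff_integrable[OF sq(2,3)] w_Suc_distance[OF k, of z0]
    by simp
  have "\<gamma>\<^sup>2 * q2 \<le> \<gamma>\<^sup>2 * (\<omega> * (L\<^sup>2 * J + D\<^sup>2))"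
    unfolding q2_def J_def by (intro mult_left_mono q_second_moment[OF k]) simp
  also have "\<dots> = 16 * \<gamma>\<^sup>2 * L\<^sup>2 * \<omega> * J / 16 + \<gamma>\<^sup>2 * \<omega> * D\<^sup>2" by (simp add: algebra_simps)
  also have "\<dots> \<le> (1 - \<tau>) * J / 16 + \<gamma>\<^sup>2 * \<omega> * D\<^sup>2"
    using mult_right_mono[OF \<gamma>1 nonneg(2)] by simp
  finally have "\<gamma>\<^sup>2 * q2 \<le> (1 - \<tau>) * J / 16 + \<gamma>\<^sup>2 * \<omega> * D\<^sup>2" .
  moreover have "0 \<le> (1 - \<tau>) * J" "(1 - \<tau>) * N \<le> 1 * N"
    using \<tau> nonneg by (auto simp only: diff_ge_0_iff_ge mult_nonneg_nonneg less_imp_le intro!: mult_right_mono)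
  \<comment> \<open>Linear bookkeeping: \<open>p\<close> stands for
    \<open>\<gamma>\<^sup>2 * q2\<close>, \<open>t\<close> and \<open>r\<close> for 1 - \<tau> times
    \<open>J\<close> and \<open>N\<close>, \<open>e\<close> for
    \<open>\<gamma>\<^sup>2 * \<omega> * D\<^sup>2\<close>, \<open>a\<close> and \<open>n\<close>
    for the mean squares of \<open>noise_sum k\<close> and \<open>noise k\<close>.\<close>
  moreover have "(a + n) / 32 + (2 * p - N / 2 - t) \<le> a / 32 + 9 / 4 * e"
    if "p \<le> t / 16 + e" "0 \<le> t" "r \<le> 1 * N" "n \<le> 8 * p + 16 * r + 16 * t" for a n p t r e :: real
    using that by (simp add: field_simps)
  ultimately show ?thesis
    unfolding sum2 rem using noise2 by (simp only: mult.assoc)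
qed

lemma noise_total:
  assumes \<gamma>1: "16 * \<gamma>\<^sup>2 * L\<^sup>2 * \<omega> \<le> 1 - \<tau>" and n: "n \<le> K"
  shows "(\<integral>x. (norm (noise_sum n x))\<^sup>2 \<partial>M) / 32 + (\<Sum>k<n. \<integral>x. remainder k x \<partial>M)
    \<le> real n * (9 / 4 * \<gamma>\<^sup>2 * \<omega> * D\<^sup>2)"
  using n
proof (induction n)
  case (Suc n)
  then show ?case using noise_step[of n, OF _ \<gamma>1] by (simp add: algebra_simps)
qed (simp add: noise_sum_def)

text \<open>Nothing is averaged: the inequality holds at each sample point for every
  \<open>u\<close>, so \<open>u\<close> may depend on the outcome. Monotonicity replaces the
  operator value at \<open>zhalf k\<close> by \<open>F u\<close>.\<close>

lemma gap_step:
  assumes mon: "strongly_monotone_problem F h Z 0 0" and u: "u \<in> dom_h" and k: "k < K" and x: "x \<in> space M"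
  shows "2 * \<gamma> * (F u \<bullet> (zhalf k x - u) + hr (zhalf k x) - hr u)
    \<le> (\<tau> * (norm (z k x - u))\<^sup>2 + (norm (w k x - u))\<^sup>2)
      - (\<tau> * (norm (z (Suc k) x - u))\<^sup>2 + (norm (w (Suc k) x - u))\<^sup>2)
      + noise k x \<bullet> (u - z0) + remainder k x"
proof -
  let ?zh = "zhalf k x" and ?zp = "z (Suc k) x"
  note step = extragradient_step[OF \<gamma> mon dom_Z u zhalf_eq[OF k x] z_Suc[OF k x]]
  have "0 \<le> (F ?zh - F u) \<bullet> (?zh - u)"
    using mon subsetD[OF dom_Z zhalf_dom[OF k x]] subsetD[OF dom_Z u]
    by (simp add: strongly_monotone_problem_def)
  then have "2 * \<gamma> * (F u \<bullet> (?zh - u)) \<le> 2 * \<gamma> * (F ?zh \<bullet> (?zh - u))"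
    using \<gamma> by (simp add: inner_diff_left)
  moreover have "(q k x + F (w k x)) \<bullet> (?zh - u) = F ?zh \<bullet> (?zh - u) + (q k x - v k x) \<bullet> (?zh - z0) - (q k x - v k x) \<bullet> (u - z0)"
    by (simp add: v_def inner_diff_left inner_diff_right inner_add_left)
  \<comment> \<open>Weight 1/2 in Young's inequality keeps half of the last step length for the coin
    noise.\<close>
  moreover have "2 * \<gamma> * (q k x \<bullet> (?zh - ?zp)) \<le> 2 * \<gamma>\<^sup>2 * (norm (q k x))\<^sup>2 + (norm (?zp - ?zh))\<^sup>2 / 2"
    using two_inner_le_weighted[of "1/2" "\<gamma> *\<^sub>R q k x" "?zh - ?zp"]
    by (simp add: power_mult_distrib norm_minus_commute)
  \<comment> \<open>The squares are expanded around \<open>z0\<close>. The coefficients 1, -\<tau>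
    and -(1 - \<tau>) add up to 0, so the square of \<open>u - z0\<close> drops out and
    \<open>u\<close> enters linearly.\<close>
  moreover have "(norm (w (Suc k) x - u))\<^sup>2 - \<tau> * (norm (w k x - u))\<^sup>2 - (1 - \<tau>) * (norm (?zp - u))\<^sup>2
    = (norm (w (Suc k) x - z0))\<^sup>2 - \<tau> * (norm (w k x - z0))\<^sup>2 - (1 - \<tau>) * (norm (?zp - z0))\<^sup>2
      - 2 * (coin_noise k x \<bullet> (u - z0))"
    unfolding power2_norm_eq_inner coin_noise_def
    by (simp add: inner_diff_left inner_diff_right inner_commute algebra_simps)
  moreover have "0 \<le> \<tau> * (norm (z k x - ?zh))\<^sup>2" using \<tau> by simp
  moreover have "noise k x \<bullet> (u - z0) = 2 * \<gamma> * ((q k x - v k x) \<bullet> (u - z0)) - 2 * (coin_noise k x \<bullet> (u - z0))"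
    by (simp add: noise_def inner_diff_left)
  ultimately show ?thesis
    using step unfolding remainder_def by (simp add: distrib_left right_diff_distrib left_diff_distrib)
qed

lemma gap_sum:
  assumes mon: "strongly_monotone_problem F h Z 0 0" and u: "u \<in> dom_h" and x: "x \<in> space M" and n: "n \<le> K"
  shows "2 * \<gamma> * (\<Sum>k<n. F u \<bullet> (zhalf k x - u) + hr (zhalf k x) - hr u)
    \<le> (\<tau> * (norm (z0 - u))\<^sup>2 + (norm (z0 - u))\<^sup>2)
      - (\<tau> * (norm (z n x - u))\<^sup>2 + (norm (w n x - u))\<^sup>2)
      + noise_sum n x \<bullet> (u - z0) + (\<Sum>k<n. remainder k x)"
  using n
proof (induction n)
  case 0
  then show ?case using x by (simp add: start noise_sum_def)
next
  case (Suc n)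
  then show ?case
    using gap_step[OF mon u, of n x] x by (simp add: noise_sum_def inner_add_left distrib_left)
qed

section \<open>The averaged iterate and its expected gap\<close>

definition zhat :: "'m \<Rightarrow> 'a" where
  "zhat x = (1 / real K) *\<^sub>R (\<Sum>k<K. zhalf k x)"

context
  fixes C :: "'a set" and zs :: 'a
  assumes C: "compact C" "C \<subseteq> Z" "zs \<in> C" and zs: "vi_solution F h Z zs"
    and mon: "strongly_monotone_problem F h Z 0 0" and K: "1 \<le> K"
    and \<gamma>1: "16 * \<gamma>\<^sup>2 * L\<^sup>2 * \<omega> \<le> 1 - \<tau>"
begin

lemma zhat_eq: "zhat x = (\<Sum>k<K. (1 / real K) *\<^sub>R zhalf k x)"
  by (simp add: zhat_def scaleR_sum_right)

lemma zhat_dom: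
  assumes "x \<in> space M"
  shows "zhat x \<in> dom_h"
  unfolding zhat_eq using K assms
  by (intro convex_sum convex_on_imp_convex[OF convex_on_hr] zhalf_dom) auto

lemma hr_zhat_le:
  assumes "x \<in> space M"
  shows "hr (zhat x) \<le> 1 / real K * (\<Sum>k<K. hr (zhalf k x))"
  unfolding zhat_eq sum_distrib_left using K assms
  by (intro convex_on_sum[OF _ _ convex_on_hr] zhalf_dom) (auto simp: lessThan_empty_iff)

text \<open>\<open>F\<close> may be discontinuous, so the bound comes from comparing with
  \<open>F zs\<close> through bounded Lipschitz continuity on the bounded set
  \<open>C\<close>.\<close>

lemma F_bounded: "\<exists>B. \<forall>u\<in>C. norm (F u) \<le> B"
proof -
  obtain R where R: "\<And>u. u \<in> C \<Longrightarrow> norm (u - zs) \<le> R"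
    using compact_imp_bounded[OF C(1)] bounded_any_center[of C zs] by (auto simp: dist_norm norm_minus_commute)
  have "norm (F u) \<le> norm (F zs) + sqrt (L\<^sup>2 * R\<^sup>2 + D\<^sup>2)" if u: "u \<in> C" for u
  proof -
    have "(norm (F u - F zs))\<^sup>2 \<le> L\<^sup>2 * (norm (u - zs))\<^sup>2 + D\<^sup>2"
      using F_lipschitz C u by (auto simp: boundedly_lipschitz_def)
    also have "\<dots> \<le> L\<^sup>2 * R\<^sup>2 + D\<^sup>2"
      using R[OF u] by (intro add_right_mono mult_left_mono power_mono) auto
    finally have "norm (F u - F zs) \<le> sqrt (L\<^sup>2 * R\<^sup>2 + D\<^sup>2)" by (rule real_le_rsqrt)
    then show ?thesis using norm_triangle_sub[of "F u" "F zs"] by linarith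
  qed
  then show ?thesis by blast
qed

lemma C_dom: "C \<inter> dom_h \<noteq> {}"
  using C(3) vi_solution_subgradient(1)[OF zs dom_Z] by blast

lemma Gap_zhat: "x \<in> space M \<Longrightarrow> Gap F h C (zhat x) = ereal (hr (zhat x) + gap_sup F C (zhat x))"
  using F_bounded Gap_eq[OF _ compact_imp_bounded[OF C(1)] C_dom zhat_dom, of F] by blast

lemma real_Gap_zhat: "x \<in> space M \<Longrightarrow> real_of_ereal (Gap F h C (zhat x)) = hr (zhat x) + gap_sup F C (zhat x)"
  by (simp add: Gap_zhat)

lemma real_Gap_measurable: "(\<lambda>x. real_of_ereal (Gap F h C (zhat x))) \<in> borel_measurable M"
proof -
  have "zhalf k \<in> borel_measurable M" if "k < K" for k
    using square_integrable_measurable[OF zhalf_sq[OF that]] .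
  then have [measurable]: "zhat \<in> borel_measurable M"
    unfolding zhat_def[abs_def] by (intro borel_measurable_scaleR borel_measurable_sum) auto
  note [measurable] = borel_measurable_hr
  have "gap_sup F C \<in> borel_measurable borel"
    using F_bounded continuous_on_gap_sup[OF _ compact_imp_bounded[OF C(1)] C_dom]
    by (blast intro: borel_measurable_continuous_onI)
  note [measurable] = this
  show ?thesis
    by (subst measurable_cong[OF real_Gap_zhat]) measurable
qed

text \<open>Testing the gap at the solution gives the lower bound that makes it integrable.\<close>
lemma real_Gap_nonneg:
  assumes x: "x \<in> space M"
  shows "0 \<le> real_of_ereal (Gap F h C (zhat x))"
proof -
  note d = zhat_dom[OF x]
  have "0 \<le> ereal (F zs \<bullet> (zhat x - zs)) + h (zhat x) - h zs"
    using zs subsetD[OF dom_Z d] by (simp add: vi_solution_def)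
  also have "\<dots> \<le> Gap F h C (zhat x)"
    unfolding Gap_def using C(3) by (intro SUP_upper)
  finally show ?thesis by (rule real_of_ereal_pos)
qed

text \<open>A bound free of \<open>u\<close> that is integrable. The constant is 10 = 2 + 8: at most
  2 from the initial potential, and 8 from half of Young's inequality with weight 16, whose other
  half gives the 1/32.\<close>

definition gap_majorant :: "'m \<Rightarrow> real" where
  "gap_majorant x = (10 * (SUP u\<in>C. (norm (z0 - u))\<^sup>2) + (norm (noise_sum K x))\<^sup>2 / 32
    + (\<Sum>k<K. remainder k x)) / (2 * \<gamma> * real K)"

lemma distance_le_SUP: "u \<in> C \<Longrightarrow> (norm (z0 - u))\<^sup>2 \<le> (SUP u\<in>C. (norm (z0 - u))\<^sup>2)"
proof (rule cSUP_upper)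
  have "compact ((\<lambda>u. (norm (z0 - u))\<^sup>2) ` C)"
    by (intro compact_continuous_image C continuous_intros)
  then show "bdd_above ((\<lambda>u. (norm (z0 - u))\<^sup>2) ` C)"
    by (intro bounded_imp_bdd_above compact_imp_bounded)
qed

text \<open>At a fixed sample point the summed one-step inequality is bounded uniformly in
  \<open>u\<close>, so the bound passes to the supremum. Averaging is exact in the operator term,
  since \<open>F\<close> is evaluated at \<open>u\<close>; \<open>hr\<close> is handled by Jensen's
  inequality.\<close>

lemma real_Gap_le:
  assumes x: "x \<in> space M"
  shows "real_of_ereal (Gap F h C (zhat x)) \<le> gap_majorant x"
proof -
  have "F u \<bullet> (zhat x - u) - hr u \<le> gap_majorant x - hr (zhat x)" if u: "u \<in> C \<inter> dom_h" for u
  proof -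
    let ?S = "\<Sum>k<K. F u \<bullet> (zhalf k x - u) + hr (zhalf k x) - hr u"
    have "2 * \<gamma> * ?S \<le> (\<tau> * (norm (z0 - u))\<^sup>2 + (norm (z0 - u))\<^sup>2)
        - (\<tau> * (norm (z K x - u))\<^sup>2 + (norm (w K x - u))\<^sup>2)
        + noise_sum K x \<bullet> (u - z0) + (\<Sum>k<K. remainder k x)"
      using gap_sum[OF mon _ x order_refl, of u] u by simp
    moreover have "2 * (noise_sum K x \<bullet> (u - z0)) \<le> (norm (noise_sum K x))\<^sup>2 / 16 + 16 * (norm (z0 - u))\<^sup>2"
      using two_inner_le_weighted[of 16 "noise_sum K x" "u - z0"] by (simp add: norm_minus_commute)
    moreover have "0 \<le> \<tau> * (norm (z K x - u))\<^sup>2" "0 \<le> (norm (w K x - u))\<^sup>2" using \<tau> by auto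
    moreover have "\<tau> * (norm (z0 - u))\<^sup>2 \<le> 1 * (norm (z0 - u))\<^sup>2" using \<tau> by (intro mult_right_mono) auto
    ultimately have "2 * \<gamma> * ?S \<le> 10 * (norm (z0 - u))\<^sup>2 + (norm (noise_sum K x))\<^sup>2 / 32 + (\<Sum>k<K. remainder k x)"
      by linarith
    also have "\<dots> \<le> gap_majorant x * (2 * \<gamma> * real K)"
      using distance_le_SUP[of u] u \<gamma> K by (simp add: gap_majorant_def)
    finally have "?S \<le> gap_majorant x * real K" using \<gamma> by simp
    then have "1 / real K * ?S \<le> gap_majorant x" using K by (simp add: field_simps)
    moreover have "?S = (\<Sum>k<K. F u \<bullet> zhalf k x) + (\<Sum>k<K. hr (zhalf k x)) - real K * (F u \<bullet> u + hr u)"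
      by (simp add: inner_diff_right sum.distrib sum_subtractf algebra_simps)
    then have "1 / real K * ?S = F u \<bullet> (zhat x - u) + 1 / real K * (\<Sum>k<K. hr (zhalf k x)) - hr u"
      using K by (simp add: zhat_def inner_diff_right inner_sum_right field_simps)
    ultimately show ?thesis using hr_zhat_le[OF x] by linarith
  qed
  then have "gap_sup F C (zhat x) \<le> gap_majorant x - hr (zhat x)"
    unfolding gap_sup_def using C_dom by (intro cSUP_least) auto
  then show ?thesis using real_Gap_zhat[OF x] by simp
qed

text \<open>Division by \<open>2 * \<gamma> * real K\<close> turns 10 into 5 and the 9/4 of each
  step into 9/8.\<close>

lemma gap_majorant_integral:
  shows "integrable M gap_majorant"
    and "(\<integral>x. gap_majorant x \<partial>M) \<le> 5 * (SUP u\<in>C. (norm (z0 - u))\<^sup>2) / (\<gamma> * real K) + 9 / 8 * \<gamma> * \<omega> * D\<^sup>2"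
proof -
  have int: "integrable M (\<lambda>x. (norm (noise_sum K x))\<^sup>2)" "\<And>k. k < K \<Longrightarrow> integrable M (remainder k)"
    using noise_sum_\<G>[of K] by (auto intro: square_integrable_norm remainder_integrable)
  have sum: "integrable M (\<lambda>x. \<Sum>k<K. remainder k x)"
    "(\<integral>x. (\<Sum>k<K. remainder k x) \<partial>M) = (\<Sum>k<K. \<integral>x. remainder k x \<partial>M)"
    using int(2) by (auto intro!: Bochner_Integration.integrable_sum Bochner_Integration.integral_sum)
  show "integrable M gap_majorant"
    unfolding gap_majorant_def[abs_def] using int(1) sum(1) by simp
  let ?R = "SUP u\<in>C. (norm (z0 - u))\<^sup>2"
  have "(\<integral>x. gap_majorant x \<partial>M) = (10 * ?R + ((\<integral>x. (norm (noise_sum K x))\<^sup>2 \<partial>M) / 32 + (\<Sum>k<K. \<integral>x. remainder k x \<partial>M))) / (2 * \<gamma> * real K)"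
    unfolding gap_majorant_def using int(1) sum by (simp add: prob_space)
  also have "\<dots> \<le> (10 * ?R + real K * (9 / 4 * \<gamma>\<^sup>2 * \<omega> * D\<^sup>2)) / (2 * \<gamma> * real K)"
    using \<gamma> by (intro divide_right_mono add_left_mono noise_total[OF \<gamma>1]) auto
  also have "\<dots> = 5 * ?R / (\<gamma> * real K) + 9 / 8 * \<gamma> * \<omega> * D\<^sup>2"
    using \<gamma> K by (simp add: field_simps power2_eq_square)
  finally show "(\<integral>x. gap_majorant x \<partial>M) \<le> 5 * ?R / (\<gamma> * real K) + 9 / 8 * \<gamma> * \<omega> * D\<^sup>2" .
qed

lemma real_Gap_integrable: "integrable M (\<lambda>x. real_of_ereal (Gap F h C (zhat x)))"
proof (rule Bochner_Integration.integrable_bound[OF gap_majorant_integral(1) real_Gap_measurable], rule AE_I2)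
  fix x assume "x \<in> space M"
  then show "norm (real_of_ereal (Gap F h C (zhat x))) \<le> norm (gap_majorant x)"
    unfolding real_norm_def using real_Gap_nonneg[of x] real_Gap_le[of x] by linarith
qed

lemma expected_Gap_le:
  "(\<integral>x. real_of_ereal (Gap F h C (zhat x)) \<partial>M)
    \<le> 5 * (SUP u\<in>C. (norm (z0 - u))\<^sup>2) / (\<gamma> * real K) + 9 / 8 * \<gamma> * \<omega> * D\<^sup>2"
proof -
  have "(\<integral>x. real_of_ereal (Gap F h C (zhat x)) \<partial>M) \<le> (\<integral>x. gap_majorant x \<partial>M)"
    by (rule integral_mono[OF real_Gap_integrable gap_majorant_integral(1) real_Gap_le])
  with gap_majorant_integral(2) show ?thesis by (rule order_trans[rotated])
qed

end

end

theorem mainTheorem8: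
  fixes h :: "'a::euclidean_space \<Rightarrow> ereal"
    and F :: "'a \<Rightarrow> 'a"
    and Z :: "'a set"
    and Q :: "'s \<Rightarrow> 'a \<Rightarrow> 'a"
    and S :: "'s measure"
    and M :: "'m measure"
    and s :: "nat \<Rightarrow> 'm \<Rightarrow> 's"
    and b :: "nat \<Rightarrow> 'm \<Rightarrow> bool"
    and z zhalf w :: "nat \<Rightarrow> 'm \<Rightarrow> 'a"
    and z0 zs :: 'a
    and L D \<omega> \<tau> \<gamma> :: real
    and K :: nat
  assumes h: "proper h" "lower_semicontinuous h" "convex_ereal h"
    and Z: "Z \<noteq> {}" "closed Z" "convex Z" "effective_domain h \<subseteq> Z"
    and \<tau>: "0 \<le> \<tau>" "\<tau> < 1"
    and zs: "vi_solution F h Z zs"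
    and F_measurable: "F \<in> borel_measurable (restrict_space borel Z)"
    and F_lipschitz: "boundedly_lipschitz F Z L D"
    and Q: "quantization S Q \<omega>"
    and M: "prob_space M"
    and choices: "independent_choices M S \<tau> K s b"
    and K: "K \<ge> 1"
    and z0: "z0 \<in> Z"
    and iterates: "\<And>x. x \<in> space M \<Longrightarrow>
      quant_ES h F Q \<gamma> \<tau> K z0 (\<lambda>k. s k x) (\<lambda>k. b k x)
        (\<lambda>k. z k x) (\<lambda>k. zhalf k x) (\<lambda>k. w k x)"
  shows
    "(\<forall>\<mu>F \<mu>h. 0 \<le> \<mu>F \<and> 0 \<le> \<mu>h \<and> 0 < \<mu>F + \<mu>h \<and>
        strongly_monotone_problem F h Z \<mu>F \<mu>h \<and>
        0 < \<gamma> \<and>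
        ereal \<gamma> \<le> min (ereal (sqrt (1 - \<tau>)) / ereal (2 * L * sqrt (2 * \<omega>)))
                       (ereal ((1 - \<tau>) / (4 * (\<mu>F + \<mu>h)))) \<longrightarrow>
        integrable M (\<lambda>x. \<tau> * (norm (z K x - zs))\<^sup>2 + (norm (w K x - zs))\<^sup>2) \<and>
        (\<integral>x. \<tau> * (norm (z K x - zs))\<^sup>2 + (norm (w K x - zs))\<^sup>2 \<partial>M)
          \<le> (1 - \<gamma> * ((\<mu>F + \<mu>h) / 16)) ^ (K - 1)
                * (\<tau> * (norm (z0 - zs))\<^sup>2 + (norm (z0 - zs))\<^sup>2)
              + 32 * \<gamma> * \<omega> * D\<^sup>2 / (\<mu>F + \<mu>h))
     \<and>
     (\<forall>C. compact C \<and> C \<subseteq> Z \<and> zs \<in> C \<and>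
        strongly_monotone_problem F h Z 0 0 \<and>
        0 < \<gamma> \<and>
        ereal \<gamma> \<le> ereal (sqrt (1 - \<tau>)) / ereal (2 * L * sqrt (4 * \<omega> + 2)) \<longrightarrow>
        (let zhat = (\<lambda>x. (1 / real K) *\<^sub>R (\<Sum>k<K. zhalf k x)) in
           (\<forall>x\<in>space M. \<bar>Gap F h C (zhat x)\<bar> \<noteq> \<infinity>) \<and>
           integrable M (\<lambda>x. real_of_ereal (Gap F h C (zhat x))) \<and>
           (\<integral>x. real_of_ereal (Gap F h C (zhat x)) \<partial>M)
             \<le> 8 * (SUP u\<in>C. (norm (z0 - u))\<^sup>2) / (\<gamma> * real K)
                 + \<gamma> * (9 * \<omega> + 2) * D\<^sup>2))"
proof (intro conjI)
  \<comment> \<open>The locale contains positivity of \<gamma>, which is assumed only within each of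
    the two cases.\<close>
  have run: "quant_ES_run h M S Q \<omega> \<tau> K s b F Z L D \<gamma> z0 z zhalf w" if "0 < \<gamma>"
    using that h Z(4) \<tau> F_measurable F_lipschitz Q M choices z0 iterates
    by (simp add: quant_ES_run_def quant_ES_run_axioms_def proper_lsc_convex_def
        random_choices_def random_choices_axioms_def)
  have L: "0 \<le> L" using F_lipschitz by (simp add: boundedly_lipschitz_def)
  show "\<forall>\<mu>F \<mu>h. 0 \<le> \<mu>F \<and> 0 \<le> \<mu>h \<and> 0 < \<mu>F + \<mu>h \<and>
        strongly_monotone_problem F h Z \<mu>F \<mu>h \<and>
        0 < \<gamma> \<and>
        ereal \<gamma> \<le> min (ereal (sqrt (1 - \<tau>)) / ereal (2 * L * sqrt (2 * \<omega>)))
                       (ereal ((1 - \<tau>) / (4 * (\<mu>F + \<mu>h)))) \<longrightarrow>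
        integrable M (\<lambda>x. \<tau> * (norm (z K x - zs))\<^sup>2 + (norm (w K x - zs))\<^sup>2) \<and>
        (\<integral>x. \<tau> * (norm (z K x - zs))\<^sup>2 + (norm (w K x - zs))\<^sup>2 \<partial>M)
          \<le> (1 - \<gamma> * ((\<mu>F + \<mu>h) / 16)) ^ (K - 1)
                * (\<tau> * (norm (z0 - zs))\<^sup>2 + (norm (z0 - zs))\<^sup>2)
              + 32 * \<gamma> * \<omega> * D\<^sup>2 / (\<mu>F + \<mu>h)"
  proof (intro allI impI, elim conjE)
    fix \<mu>F \<mu>h
    assume \<mu>: "0 \<le> \<mu>F" "0 \<le> \<mu>h" "0 < \<mu>F + \<mu>h" and mon: "strongly_monotone_problem F h Z \<mu>F \<mu>h"
      and \<gamma>: "0 < \<gamma>" and step: "ereal \<gamma> \<le> min (ereal (sqrt (1 - \<tau>)) / ereal (2 * L * sqrt (2 * \<omega>)))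
                       (ereal ((1 - \<tau>) / (4 * (\<mu>F + \<mu>h))))"
    interpret quant_ES_run h M S Q \<omega> \<tau> K s b F Z L D \<gamma> z0 z zhalf w by (rule run[OF \<gamma>])
    note \<omega> = \<omega>_nonneg
    have "4 * \<gamma>\<^sup>2 * L\<^sup>2 * (2 * \<omega>) \<le> 1 - \<tau>"
      using step \<omega> by (intro step_size_square[OF \<gamma> \<tau>(2) L]) (auto simp del: ereal_divide)
    then have \<gamma>1: "8 * \<gamma>\<^sup>2 * L\<^sup>2 * \<omega> \<le> 1 - \<tau>" by (simp add: algebra_simps)
    have "\<gamma> \<le> (1 - \<tau>) / (4 * (\<mu>F + \<mu>h))" using step by (metis ereal_less_eq(3) min.bounded_iff)
    then have \<gamma>2: "4 * \<gamma> * (\<mu>F + \<mu>h) \<le> 1 - \<tau>" using \<mu> by (simp add: field_simps)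
    define c where "c = \<gamma> * (\<mu>F + \<mu>h)"
    define V0 where "V0 = \<tau> * (norm (z0 - zs))\<^sup>2 + (norm (z0 - zs))\<^sup>2"
    have c: "0 \<le> c" "4 * c \<le> 1" using \<gamma> \<mu> \<gamma>2 \<tau> by (simp_all add: c_def)
    have V0: "0 \<le> V0" using \<tau> by (simp add: V0_def)
    note int = norm_diff_integrable[OF z_sq[OF order_refl] square_integrable_const[of zs]]
      norm_diff_integrable[OF w_sq[OF order_refl] square_integrable_const[of zs]]
    have "(\<integral>x. \<tau> * (norm (z K x - zs))\<^sup>2 + (norm (w K x - zs))\<^sup>2 \<partial>M)
      \<le> (1 - c / 4) ^ K * V0 + 4 * \<gamma> * \<omega> * D\<^sup>2 / (\<mu>F + \<mu>h)"
      using strongly_monotone_rate[OF mon \<mu> zs \<gamma>1 \<gamma>2 order_refl] int by (simp add: c_def V0_def)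
    \<comment> \<open>The base lies between 0 and 1, so lowering the exponent to
      \<open>K - 1\<close> and the rate from 1/4 to 1/16 can only enlarge the power.\<close>
    also have "(1 - c / 4) ^ K * V0 \<le> (1 - \<gamma> * ((\<mu>F + \<mu>h) / 16)) ^ (K - 1) * V0"
    proof (intro mult_right_mono V0)
      have "(1 - c / 4) ^ K \<le> (1 - c / 4) ^ (K - 1)" using c by (intro power_decreasing) auto
      also have "\<dots> \<le> (1 - \<gamma> * ((\<mu>F + \<mu>h) / 16)) ^ (K - 1)"
        using c by (intro power_mono) (auto simp: c_def)
      finally show "(1 - c / 4) ^ K \<le> (1 - \<gamma> * ((\<mu>F + \<mu>h) / 16)) ^ (K - 1)" .
    qed
    also have "4 * \<gamma> * \<omega> * D\<^sup>2 / (\<mu>F + \<mu>h) \<le> 32 * \<gamma> * \<omega> * D\<^sup>2 / (\<mu>F + \<mu>h)"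
      using \<gamma> \<omega> \<mu> by (intro divide_right_mono mult_right_mono) auto
    finally show "integrable M (\<lambda>x. \<tau> * (norm (z K x - zs))\<^sup>2 + (norm (w K x - zs))\<^sup>2) \<and>
        (\<integral>x. \<tau> * (norm (z K x - zs))\<^sup>2 + (norm (w K x - zs))\<^sup>2 \<partial>M)
          \<le> (1 - \<gamma> * ((\<mu>F + \<mu>h) / 16)) ^ (K - 1)
                * (\<tau> * (norm (z0 - zs))\<^sup>2 + (norm (z0 - zs))\<^sup>2)
              + 32 * \<gamma> * \<omega> * D\<^sup>2 / (\<mu>F + \<mu>h)"
      using int by (simp add: V0_def)
  qed
  show "\<forall>C. compact C \<and> C \<subseteq> Z \<and> zs \<in> C \<and>
        strongly_monotone_problem F h Z 0 0 \<and>
        0 < \<gamma> \<and>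
        ereal \<gamma> \<le> ereal (sqrt (1 - \<tau>)) / ereal (2 * L * sqrt (4 * \<omega> + 2)) \<longrightarrow>
        (let zhat = (\<lambda>x. (1 / real K) *\<^sub>R (\<Sum>k<K. zhalf k x)) in
           (\<forall>x\<in>space M. \<bar>Gap F h C (zhat x)\<bar> \<noteq> \<infinity>) \<and>
           integrable M (\<lambda>x. real_of_ereal (Gap F h C (zhat x))) \<and>
           (\<integral>x. real_of_ereal (Gap F h C (zhat x)) \<partial>M)
             \<le> 8 * (SUP u\<in>C. (norm (z0 - u))\<^sup>2) / (\<gamma> * real K)
                 + \<gamma> * (9 * \<omega> + 2) * D\<^sup>2)"
  proof (intro allI impI, elim conjE)
    fix C
    assume C: "compact C" "C \<subseteq> Z" "zs \<in> C" and mon: "strongly_monotone_problem F h Z 0 0"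
      and \<gamma>: "0 < \<gamma>" and step: "ereal \<gamma> \<le> ereal (sqrt (1 - \<tau>)) / ereal (2 * L * sqrt (4 * \<omega> + 2))"
    interpret quant_ES_run h M S Q \<omega> \<tau> K s b F Z L D \<gamma> z0 z zhalf w by (rule run[OF \<gamma>])
    note \<omega> = \<omega>_nonneg
    have "4 * \<gamma>\<^sup>2 * L\<^sup>2 * (4 * \<omega> + 2) \<le> 1 - \<tau>"
      using \<omega> by (intro step_size_square[OF \<gamma> \<tau>(2) L _ step]) simp
    moreover have "4 * \<gamma>\<^sup>2 * L\<^sup>2 * (4 * \<omega> + 2) = 16 * \<gamma>\<^sup>2 * L\<^sup>2 * \<omega> + 8 * (\<gamma> * L)\<^sup>2"
      by (simp add: algebra_simps)
    ultimately have \<gamma>1: "16 * \<gamma>\<^sup>2 * L\<^sup>2 * \<omega> \<le> 1 - \<tau>" using zero_le_power2[of "\<gamma> * L"] by linarith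
    let ?R = "SUP u\<in>C. (norm (z0 - u))\<^sup>2"
    note gap = C zs mon K \<gamma>1
    \<comment> \<open>The point \<open>zs\<close> of \<open>C\<close> witnesses that the supremum
      dominates a square, which is what allows 5 to be enlarged to 8.\<close>
    have "0 \<le> ?R" using distance_le_SUP[OF gap C(3)] by (rule order_trans[rotated]) simp
    then have "5 * ?R / (\<gamma> * real K) \<le> 8 * ?R / (\<gamma> * real K)"
      using \<gamma> by (intro divide_right_mono) auto
    moreover have "9 / 8 * \<gamma> * \<omega> * D\<^sup>2 \<le> \<gamma> * (9 * \<omega> + 2) * D\<^sup>2"
    proof -
      have "9 / 8 * \<omega> * (\<gamma> * D\<^sup>2) \<le> (9 * \<omega> + 2) * (\<gamma> * D\<^sup>2)"
        using \<omega> \<gamma> by (intro mult_right_mono) auto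
      then show ?thesis by (simp add: ac_simps)
    qed
    ultimately show "let zhat = (\<lambda>x. (1 / real K) *\<^sub>R (\<Sum>k<K. zhalf k x)) in
           (\<forall>x\<in>space M. \<bar>Gap F h C (zhat x)\<bar> \<noteq> \<infinity>) \<and>
           integrable M (\<lambda>x. real_of_ereal (Gap F h C (zhat x))) \<and>
           (\<integral>x. real_of_ereal (Gap F h C (zhat x)) \<partial>M)
             \<le> 8 * ?R / (\<gamma> * real K) + \<gamma> * (9 * \<omega> + 2) * D\<^sup>2"
      using Gap_zhat[OF gap] real_Gap_integrable[OF gap] expected_Gap_le[OF gap]
      unfolding Let_def zhat_def by auto
  qed
qed

end
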